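(* Let $Z=x_0D_{12}+x_1D_{13}+x_2D_{23}+x_3D_{45}+x_4D_{46}+x_5D_{47}\in\mathfrak k_A$ and $L_Z=\operatorname{Lie}\{Z,\operatorname{Ad}_SZ\}$. (i) $L_Z$ is abelian if and only if $x_0=x_1=x_4=x_5=0$. On this plane $Z=x_2D_{23}+x_3D_{45}$, and $\dim L_Z$ is $0$ at the origin, $1$ at the nonzero points of the two lines $x_2=x_3$ and $x_2=-x_3$, and $2$ elsewhere. (ii) If $Z$ is outside this plane, then $\dim L_Z\le3$ if and only if $a_1=b_1=0$ and either $$q=0,\quad p\neq0,$$ or $$q\neq0,\qquad |q|^2p=\eta q^3\quad\text{for some }\eta\in\{1,-1,-3\}.$$ In every case in (ii) with $\dim L_Z\le 3$, $L_Z$ is isomorphic to $\mathfrak{su}(2)$ and has dimension exactly three. The dimension of the common fixed space $\{w\in V:Zw=(\operatorname{Ad}_SZ)w=0\}$ in the cases of (ii) is one for $q=0$, and three, one, zero for $\eta=1,-1,-3$ respectively.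
   Context: Octonions: $\mathbb O$ has real basis $1,e_1,\dots,e_7$ with $1$ the identity, $e_i^2=-1$, and multiplication given by the oriented triples $(123),(145),(176),(246),(257),(347),(365)$: for a triple $(abc)$, $e_ae_b=e_c$, $e_be_c=e_a$, $e_ce_a=e_b$, and reversing the order changes the sign. $V=\operatorname{Im}\mathbb O$. $G_2=\operatorname{Aut}(\mathbb O)$, $\mathfrak g_2=\operatorname{Der}(\mathbb O)$, acting on $V$. $D_{ij}=D_{e_i,e_j}\in\mathfrak g_2$ with $D_{a,b}(x)=[[a,b],x]-3[a,b,x]$, $[a,b]=ab-ba$, $[a,b,x]=(ab)x-a(bx)$. $H_A=\operatorname{span}\{1,e_1,e_2,e_3\}$ and $\mathfrak k_A=\{Z\in\mathfrak g_2:Z(H_A)\subseteq H_A\}$, with basis $D_{12},D_{13},D_{23},D_{45},D_{46},D_{47}$. $S\in G_2$ is the involution $S(e_1)=e_1$, $e_2\leftrightarrow e_4$, $e_3\leftrightarrow e_5$, $S(e_6)=-e_6$, $S(e_7)=-e_7$; $\operatorname{Ad}_SZ=SZS^{-1}$. $\operatorname{Lie}\{U,W\}$ is the smallest real Lie subalgebra containing $U,W$. Coordinates: $(a_1,a_2,a_3)=(2x_2-x_3,-2x_1-x_4,2x_0-x_5)$, $(b_1,b_2,b_3)=3(x_3,x_4,x_5)$, $q=a_2+ia_3\in\mathbb C$, $p=b_2+ib_3\in\mathbb C$. *)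

theory Defs
  imports "HOL-Analysis.Analysis"
begin

section \<open>Octonions\<close>

text \<open>
  The octonions are the real vector space \<open>real ^ 8\<close>. The index type \<open>8\<close> consists of the
  residues \<open>0, \<dots>, 7\<close>; the coordinate \<open>0\<close> belongs to the identity and the coordinate
  \<open>i \<noteq> 0\<close> to the imaginary unit \<open>oe i\<close>.
\<close>

type_synonym octo = "real ^ 8"

definition oe :: "8 \<Rightarrow> octo" where
  "oe i = axis i 1"

definition oriented_triples :: "(8 \<times> 8 \<times> 8) set" where
  "oriented_triples =
     {(1,2,3), (1,4,5), (1,7,6), (2,4,6), (2,5,7), (3,4,7), (3,6,5)}"

definition cyclic_triple :: "8 \<Rightarrow> 8 \<Rightarrow> 8 \<Rightarrow> bool" where
  "cyclic_triple a b c \<longleftrightarrow>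
     (a,b,c) \<in> oriented_triples \<or> (b,c,a) \<in> oriented_triples \<or> (c,a,b) \<in> oriented_triples"

definition unit_mult :: "8 \<Rightarrow> 8 \<Rightarrow> octo" where
  "unit_mult i j =
     (if i = 0 then oe j
      else if j = 0 then oe i
      else if i = j then - oe 0
      else (\<chi> k. if cyclic_triple i j k then 1 else if cyclic_triple j i k then -1 else 0))"

definition octo_mult :: "octo \<Rightarrow> octo \<Rightarrow> octo" (infixl "\<odot>" 70) where
  "x \<odot> y = (\<Sum>i\<in>UNIV. \<Sum>j\<in>UNIV. (x $ i * y $ j) *\<^sub>R unit_mult i j)"

definition ImO :: "octo set" where
  "ImO = span (oe ` {i. i \<noteq> 0})"

definition octo_commutator :: "octo \<Rightarrow> octo \<Rightarrow> octo" where
  "octo_commutator a b = a \<odot> b - b \<odot> a"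

definition octo_associator :: "octo \<Rightarrow> octo \<Rightarrow> octo \<Rightarrow> octo" where
  "octo_associator a b x = (a \<odot> b) \<odot> x - a \<odot> (b \<odot> x)"

section \<open>The group and the Lie algebra of type G2\<close>

text \<open>Linear endomorphisms of the octonions are given by their matrices in the basis \<open>oe\<close>.\<close>

definition G2 :: "(real ^ 8 ^ 8) set" where
  "G2 = {g. invertible g \<and> (\<forall>x y. g *v (x \<odot> y) = (g *v x) \<odot> (g *v y))}"

definition g2 :: "(real ^ 8 ^ 8) set" where
  "g2 = {Z. \<forall>x y. Z *v (x \<odot> y) = (Z *v x) \<odot> y + x \<odot> (Z *v y)}"

definition HA :: "octo set" where
  "HA = span {oe 0, oe 1, oe 2, oe 3}"

definition kA :: "(real ^ 8 ^ 8) set" where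
  "kA = {Z \<in> g2. (\<lambda>x. Z *v x) ` HA \<subseteq> HA}"

definition octo_der :: "octo \<Rightarrow> octo \<Rightarrow> real ^ 8 ^ 8" where
  "octo_der a b = matrix (\<lambda>x. octo_commutator (octo_commutator a b) x - 3 *\<^sub>R octo_associator a b x)"

definition Dij :: "8 \<Rightarrow> 8 \<Rightarrow> real ^ 8 ^ 8" where
  "Dij i j = octo_der (oe i) (oe j)"

definition invol_unit :: "8 \<Rightarrow> octo" where
  "invol_unit j =
     (if j = 0 then oe 0 else if j = 1 then oe 1
      else if j = 2 then oe 4 else if j = 4 then oe 2
      else if j = 3 then oe 5 else if j = 5 then oe 3
      else if j = 6 then - oe 6 else - oe 7)"

text \<open>Column \<open>j\<close> of the matrix is the image of \<open>oe j\<close>.\<close>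

definition Sinvol :: "real ^ 8 ^ 8" where
  "Sinvol = (\<chi> i j. invol_unit j $ i)"

definition AdS :: "real ^ 8 ^ 8 \<Rightarrow> real ^ 8 ^ 8" where
  "AdS Z = Sinvol ** Z ** matrix_inv Sinvol"

section \<open>Real Lie algebras of matrices\<close>

definition lie_bracket :: "'a::real_algebra_1 ^ 'n ^ 'n \<Rightarrow> 'a ^ 'n ^ 'n \<Rightarrow> 'a ^ 'n ^ 'n" where
  "lie_bracket X Y = X ** Y - Y ** X"

definition lie_subalgebra :: "('a::real_algebra_1 ^ 'n ^ 'n) set \<Rightarrow> bool" where
  "lie_subalgebra L \<longleftrightarrow> subspace L \<and> (\<forall>X\<in>L. \<forall>Y\<in>L. lie_bracket X Y \<in> L)"

text \<open>
  The intersection of all real Lie subalgebras of the matrix algebra that contain \<open>U\<close> and \<open>W\<close>.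
  Since \<open>g2\<close> is itself a Lie subalgebra (lemma \<open>lie_subalgebra_g2\<close> below), for \<open>U, W \<in> g2\<close> this is also the smallest Lie
  subalgebra of \<open>g2\<close> containing them.
\<close>

definition lie_generated :: "'a::real_algebra_1 ^ 'n ^ 'n \<Rightarrow> 'a ^ 'n ^ 'n \<Rightarrow> ('a ^ 'n ^ 'n) set" where
  "lie_generated U W = lie_subalgebra hull {U, W}"

definition lie_abelian :: "('a::real_algebra_1 ^ 'n ^ 'n) set \<Rightarrow> bool" where
  "lie_abelian L \<longleftrightarrow> (\<forall>X\<in>L. \<forall>Y\<in>L. lie_bracket X Y = 0)"

definition lie_isomorphic ::
    "('a::real_algebra_1 ^ 'n ^ 'n) set \<Rightarrow> ('b::real_algebra_1 ^ 'm ^ 'm) set \<Rightarrow> bool" where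
  "lie_isomorphic L M \<longleftrightarrow>
     (\<exists>\<phi>. bij_betw \<phi> L M \<and>
          (\<forall>X\<in>L. \<forall>Y\<in>L. \<phi> (X + Y) = \<phi> X + \<phi> Y) \<and>
          (\<forall>X\<in>L. \<forall>c::real. \<phi> (c *\<^sub>R X) = c *\<^sub>R \<phi> X) \<and>
          (\<forall>X\<in>L. \<forall>Y\<in>L. \<phi> (lie_bracket X Y) = lie_bracket (\<phi> X) (\<phi> Y)))"

definition su2 :: "(complex ^ 2 ^ 2) set" where
  "su2 = {A. (\<chi> i j. cnj (A $ j $ i)) = - A \<and> trace A = 0}"

definition common_fixed_space :: "real ^ 8 ^ 8 \<Rightarrow> octo set" where
  "common_fixed_space Z = {w \<in> ImO. Z *v w = 0 \<and> AdS Z *v w = 0}"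

section \<open>Membership of the given elements in G2, g2 and kA\<close>

lemma UNIV_index8: "(UNIV :: 8 set) = {0,1,2,3,4,5,6,7}"
proof -
  have "i \<in> {0,1,2,3,4,5,6,7}" for i :: 8
  proof (cases i rule: bit0_cases)
    case (of_int z)
    then have "z = 0 \<or> z = 1 \<or> z = 2 \<or> z = 3 \<or> z = 4 \<or> z = 5 \<or> z = 6 \<or> z = 7" by auto
    then show ?thesis using of_int by auto
  qed
  then show ?thesis by auto
qed

lemma sum_index8: "sum f (UNIV :: 8 set) = f 0 + f 1 + f 2 + f 3 + f 4 + f 5 + f 6 + f 7"
  unfolding UNIV_index8 by (simp add: algebra_simps)

lemma oe_nth: "oe i $ j = (if j = i then 1 else 0)"
  by (simp add: oe_def axis_def)

lemma index8_neq:
    "(0 :: 8) \<noteq> 1" "(0 :: 8) \<noteq> 2" "(0 :: 8) \<noteq> 3" "(0 :: 8) \<noteq> 4" "(0 :: 8) \<noteq> 5" "(0 :: 8) \<noteq> 6" "(0 :: 8) \<noteq> 7"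
    "(1 :: 8) \<noteq> 0" "(1 :: 8) \<noteq> 2" "(1 :: 8) \<noteq> 3" "(1 :: 8) \<noteq> 4" "(1 :: 8) \<noteq> 5" "(1 :: 8) \<noteq> 6" "(1 :: 8) \<noteq> 7"
    "(2 :: 8) \<noteq> 0" "(2 :: 8) \<noteq> 1" "(2 :: 8) \<noteq> 3" "(2 :: 8) \<noteq> 4" "(2 :: 8) \<noteq> 5" "(2 :: 8) \<noteq> 6" "(2 :: 8) \<noteq> 7"
    "(3 :: 8) \<noteq> 0" "(3 :: 8) \<noteq> 1" "(3 :: 8) \<noteq> 2" "(3 :: 8) \<noteq> 4" "(3 :: 8) \<noteq> 5" "(3 :: 8) \<noteq> 6" "(3 :: 8) \<noteq> 7"
    "(4 :: 8) \<noteq> 0" "(4 :: 8) \<noteq> 1" "(4 :: 8) \<noteq> 2" "(4 :: 8) \<noteq> 3" "(4 :: 8) \<noteq> 5" "(4 :: 8) \<noteq> 6" "(4 :: 8) \<noteq> 7"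
    "(5 :: 8) \<noteq> 0" "(5 :: 8) \<noteq> 1" "(5 :: 8) \<noteq> 2" "(5 :: 8) \<noteq> 3" "(5 :: 8) \<noteq> 4" "(5 :: 8) \<noteq> 6" "(5 :: 8) \<noteq> 7"
    "(6 :: 8) \<noteq> 0" "(6 :: 8) \<noteq> 1" "(6 :: 8) \<noteq> 2" "(6 :: 8) \<noteq> 3" "(6 :: 8) \<noteq> 4" "(6 :: 8) \<noteq> 5" "(6 :: 8) \<noteq> 7"
    "(7 :: 8) \<noteq> 0" "(7 :: 8) \<noteq> 1" "(7 :: 8) \<noteq> 2" "(7 :: 8) \<noteq> 3" "(7 :: 8) \<noteq> 4" "(7 :: 8) \<noteq> 5" "(7 :: 8) \<noteq> 6"
  by simp_all

lemma unit_mult_rows: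
  fixes y :: octo
  shows
  "(\<Sum>j\<in>UNIV. y $ j * unit_mult 0 j $ 0) = y$0"  "(\<Sum>j\<in>UNIV. y $ j * unit_mult 1 j $ 0) = -y$1"
  "(\<Sum>j\<in>UNIV. y $ j * unit_mult 2 j $ 0) = -y$2"  "(\<Sum>j\<in>UNIV. y $ j * unit_mult 3 j $ 0) = -y$3"
  "(\<Sum>j\<in>UNIV. y $ j * unit_mult 4 j $ 0) = -y$4"  "(\<Sum>j\<in>UNIV. y $ j * unit_mult 5 j $ 0) = -y$5"
  "(\<Sum>j\<in>UNIV. y $ j * unit_mult 6 j $ 0) = -y$6"  "(\<Sum>j\<in>UNIV. y $ j * unit_mult 7 j $ 0) = -y$7"
  "(\<Sum>j\<in>UNIV. y $ j * unit_mult 0 j $ 1) = y$1"  "(\<Sum>j\<in>UNIV. y $ j * unit_mult 1 j $ 1) = y$0"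
  "(\<Sum>j\<in>UNIV. y $ j * unit_mult 2 j $ 1) = y$3"  "(\<Sum>j\<in>UNIV. y $ j * unit_mult 3 j $ 1) = -y$2"
  "(\<Sum>j\<in>UNIV. y $ j * unit_mult 4 j $ 1) = y$5"  "(\<Sum>j\<in>UNIV. y $ j * unit_mult 5 j $ 1) = -y$4"
  "(\<Sum>j\<in>UNIV. y $ j * unit_mult 6 j $ 1) = -y$7"  "(\<Sum>j\<in>UNIV. y $ j * unit_mult 7 j $ 1) = y$6"
  "(\<Sum>j\<in>UNIV. y $ j * unit_mult 0 j $ 2) = y$2"  "(\<Sum>j\<in>UNIV. y $ j * unit_mult 1 j $ 2) = -y$3"
  "(\<Sum>j\<in>UNIV. y $ j * unit_mult 2 j $ 2) = y$0"  "(\<Sum>j\<in>UNIV. y $ j * unit_mult 3 j $ 2) = y$1"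
  "(\<Sum>j\<in>UNIV. y $ j * unit_mult 4 j $ 2) = y$6"  "(\<Sum>j\<in>UNIV. y $ j * unit_mult 5 j $ 2) = y$7"
  "(\<Sum>j\<in>UNIV. y $ j * unit_mult 6 j $ 2) = -y$4"  "(\<Sum>j\<in>UNIV. y $ j * unit_mult 7 j $ 2) = -y$5"
  "(\<Sum>j\<in>UNIV. y $ j * unit_mult 0 j $ 3) = y$3"  "(\<Sum>j\<in>UNIV. y $ j * unit_mult 1 j $ 3) = y$2"
  "(\<Sum>j\<in>UNIV. y $ j * unit_mult 2 j $ 3) = -y$1"  "(\<Sum>j\<in>UNIV. y $ j * unit_mult 3 j $ 3) = y$0"
  "(\<Sum>j\<in>UNIV. y $ j * unit_mult 4 j $ 3) = y$7"  "(\<Sum>j\<in>UNIV. y $ j * unit_mult 5 j $ 3) = -y$6"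
  "(\<Sum>j\<in>UNIV. y $ j * unit_mult 6 j $ 3) = y$5"  "(\<Sum>j\<in>UNIV. y $ j * unit_mult 7 j $ 3) = -y$4"
  "(\<Sum>j\<in>UNIV. y $ j * unit_mult 0 j $ 4) = y$4"  "(\<Sum>j\<in>UNIV. y $ j * unit_mult 1 j $ 4) = -y$5"
  "(\<Sum>j\<in>UNIV. y $ j * unit_mult 2 j $ 4) = -y$6"  "(\<Sum>j\<in>UNIV. y $ j * unit_mult 3 j $ 4) = -y$7"
  "(\<Sum>j\<in>UNIV. y $ j * unit_mult 4 j $ 4) = y$0"  "(\<Sum>j\<in>UNIV. y $ j * unit_mult 5 j $ 4) = y$1"
  "(\<Sum>j\<in>UNIV. y $ j * unit_mult 6 j $ 4) = y$2"  "(\<Sum>j\<in>UNIV. y $ j * unit_mult 7 j $ 4) = y$3"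
  "(\<Sum>j\<in>UNIV. y $ j * unit_mult 0 j $ 5) = y$5"  "(\<Sum>j\<in>UNIV. y $ j * unit_mult 1 j $ 5) = y$4"
  "(\<Sum>j\<in>UNIV. y $ j * unit_mult 2 j $ 5) = -y$7"  "(\<Sum>j\<in>UNIV. y $ j * unit_mult 3 j $ 5) = y$6"
  "(\<Sum>j\<in>UNIV. y $ j * unit_mult 4 j $ 5) = -y$1"  "(\<Sum>j\<in>UNIV. y $ j * unit_mult 5 j $ 5) = y$0"
  "(\<Sum>j\<in>UNIV. y $ j * unit_mult 6 j $ 5) = -y$3"  "(\<Sum>j\<in>UNIV. y $ j * unit_mult 7 j $ 5) = y$2"
  "(\<Sum>j\<in>UNIV. y $ j * unit_mult 0 j $ 6) = y$6"  "(\<Sum>j\<in>UNIV. y $ j * unit_mult 1 j $ 6) = y$7"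
  "(\<Sum>j\<in>UNIV. y $ j * unit_mult 2 j $ 6) = y$4"  "(\<Sum>j\<in>UNIV. y $ j * unit_mult 3 j $ 6) = -y$5"
  "(\<Sum>j\<in>UNIV. y $ j * unit_mult 4 j $ 6) = -y$2"  "(\<Sum>j\<in>UNIV. y $ j * unit_mult 5 j $ 6) = y$3"
  "(\<Sum>j\<in>UNIV. y $ j * unit_mult 6 j $ 6) = y$0"  "(\<Sum>j\<in>UNIV. y $ j * unit_mult 7 j $ 6) = -y$1"
  "(\<Sum>j\<in>UNIV. y $ j * unit_mult 0 j $ 7) = y$7"  "(\<Sum>j\<in>UNIV. y $ j * unit_mult 1 j $ 7) = -y$6"
  "(\<Sum>j\<in>UNIV. y $ j * unit_mult 2 j $ 7) = y$5"  "(\<Sum>j\<in>UNIV. y $ j * unit_mult 3 j $ 7) = y$4"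
  "(\<Sum>j\<in>UNIV. y $ j * unit_mult 4 j $ 7) = -y$3"  "(\<Sum>j\<in>UNIV. y $ j * unit_mult 5 j $ 7) = -y$2"
  "(\<Sum>j\<in>UNIV. y $ j * unit_mult 6 j $ 7) = y$1"  "(\<Sum>j\<in>UNIV. y $ j * unit_mult 7 j $ 7) = y$0"
  unfolding sum_index8
  by (simp_all only: unit_mult_def oe_nth cyclic_triple_def oriented_triples_def index8_neq
      insert_iff empty_iff prod.inject simp_thms if_True if_False vec_lambda_beta
      vector_uminus_component mult_zero_right mult_1_right mult_minus1_right minus_zero
      add_0_left add_0_right)

lemma octo_mult_nth:
  "(x \<odot> y) $ k = (\<Sum>i\<in>UNIV. x $ i * (\<Sum>j\<in>UNIV. y $ j * unit_mult i j $ k))"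
  by (simp add: octo_mult_def sum_distrib_left mult.assoc)

lemma mult_comps:
  fixes x y :: octo
  shows
  "(x \<odot> y) $ 0 = x$0*y$0 - x$1*y$1 - x$2*y$2 - x$3*y$3 - x$4*y$4 - x$5*y$5 - x$6*y$6 - x$7*y$7"
  "(x \<odot> y) $ 1 = x$0*y$1 + x$1*y$0 + x$2*y$3 - x$3*y$2 + x$4*y$5 - x$5*y$4 - x$6*y$7 + x$7*y$6"
  "(x \<odot> y) $ 2 = x$0*y$2 - x$1*y$3 + x$2*y$0 + x$3*y$1 + x$4*y$6 + x$5*y$7 - x$6*y$4 - x$7*y$5"
  "(x \<odot> y) $ 3 = x$0*y$3 + x$1*y$2 - x$2*y$1 + x$3*y$0 + x$4*y$7 - x$5*y$6 + x$6*y$5 - x$7*y$4"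
  "(x \<odot> y) $ 4 = x$0*y$4 - x$1*y$5 - x$2*y$6 - x$3*y$7 + x$4*y$0 + x$5*y$1 + x$6*y$2 + x$7*y$3"
  "(x \<odot> y) $ 5 = x$0*y$5 + x$1*y$4 - x$2*y$7 + x$3*y$6 - x$4*y$1 + x$5*y$0 - x$6*y$3 + x$7*y$2"
  "(x \<odot> y) $ 6 = x$0*y$6 + x$1*y$7 + x$2*y$4 - x$3*y$5 - x$4*y$2 + x$5*y$3 + x$6*y$0 - x$7*y$1"
  "(x \<odot> y) $ 7 = x$0*y$7 - x$1*y$6 + x$2*y$5 + x$3*y$4 - x$4*y$3 - x$5*y$2 + x$6*y$1 + x$7*y$0"
  unfolding octo_mult_nth sum_index8[of "\<lambda>i. x $ i * f i" for f]
  by (simp_all only: unit_mult_rows mult_minus_right add_uminus_conv_diff)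

lemma vec8_eq: "(x :: 'a ^ 8) = y \<longleftrightarrow> x $ 0 = y $ 0 \<and> x $ 1 = y $ 1 \<and> x $ 2 = y $ 2 \<and> x $ 3 = y $ 3
    \<and> x $ 4 = y $ 4 \<and> x $ 5 = y $ 5 \<and> x $ 6 = y $ 6 \<and> x $ 7 = y $ 7"
proof -
  have "(\<forall>i::8. x $ i = y $ i) \<longleftrightarrow> (\<forall>i\<in>{0,1,2,3,4,5,6,7}. x $ i = y $ i)"
    unfolding UNIV_index8[symmetric] by simp
  then show ?thesis by (simp add: vec_eq_iff)
qed

lemma octo_mult_linear:
  "(x + y) \<odot> z = x \<odot> z + y \<odot> z" "x \<odot> (y + z) = x \<odot> y + x \<odot> z"
  "(x - y) \<odot> z = x \<odot> z - y \<odot> z" "x \<odot> (y - z) = x \<odot> y - x \<odot> z"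
  "0 \<odot> z = 0" "x \<odot> 0 = 0"
  "(c *\<^sub>R x) \<odot> z = c *\<^sub>R (x \<odot> z)" "x \<odot> (c *\<^sub>R z) = c *\<^sub>R (x \<odot> z)"
  by (simp_all add: vec8_eq mult_comps algebra_simps)

lemma octo_der_apply:
  "octo_der a b *v x = octo_commutator (octo_commutator a b) x - 3 *\<^sub>R octo_associator a b x"
proof -
  have "linear (\<lambda>x. octo_commutator (octo_commutator a b) x - 3 *\<^sub>R octo_associator a b x)"
    by (rule linearI)
       (simp_all add: octo_commutator_def octo_associator_def octo_mult_linear algebra_simps)
  then have "Vector_Spaces.linear (*s) (*s)
      (\<lambda>x. octo_commutator (octo_commutator a b) x - 3 *\<^sub>R octo_associator a b x)"
    by (simp add: scalar_mult_eq_scaleR[abs_def] linear_def)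
  then show ?thesis
    unfolding octo_der_def by (rule matrix_works)
qed

lemma Sinvol_sq: "Sinvol ** Sinvol = mat 1"
  by (simp add: vec8_eq matrix_matrix_mult_def mat_def Sinvol_def sum_index8 invol_unit_def oe_nth)

lemma Sinvol_apply:
  "(Sinvol *v x) $ 0 = x $ 0" "(Sinvol *v x) $ 1 = x $ 1" "(Sinvol *v x) $ 2 = x $ 4"
  "(Sinvol *v x) $ 3 = x $ 5" "(Sinvol *v x) $ 4 = x $ 2" "(Sinvol *v x) $ 5 = x $ 3"
  "(Sinvol *v x) $ 6 = - x $ 6" "(Sinvol *v x) $ 7 = - x $ 7"
  by (simp_all add: matrix_vector_mult_def Sinvol_def sum_index8 invol_unit_def oe_nth)

lemma Sinvol_G2: "Sinvol \<in> G2"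
  unfolding G2_def
proof safe
  show "invertible Sinvol" using Sinvol_sq invertible_def by blast
  show "Sinvol *v (x \<odot> y) = (Sinvol *v x) \<odot> (Sinvol *v y)" for x y
    by (simp add: vec8_eq mult_comps Sinvol_apply)
qed

lemma oe_mult_nth: "(oe i \<odot> y) $ k = (\<Sum>j\<in>UNIV. y $ j * unit_mult i j $ k)"
  by (simp add: octo_mult_nth oe_nth if_distribR if_distrib[of "\<lambda>t. t * _"] cong: if_cong)

lemmas oe_mult_rows = unit_mult_rows[folded oe_mult_nth]

lemma oe_mult_oe:
  "oe 1 \<odot> oe 2 = oe 3" "oe 2 \<odot> oe 1 = - oe 3"
  "oe 1 \<odot> oe 3 = - oe 2" "oe 3 \<odot> oe 1 = oe 2"
  "oe 2 \<odot> oe 3 = oe 1" "oe 3 \<odot> oe 2 = - oe 1"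
  "oe 4 \<odot> oe 5 = oe 1" "oe 5 \<odot> oe 4 = - oe 1"
  "oe 4 \<odot> oe 6 = oe 2" "oe 6 \<odot> oe 4 = - oe 2"
  "oe 4 \<odot> oe 7 = oe 3" "oe 7 \<odot> oe 4 = - oe 3"
  unfolding vec8_eq oe_mult_rows by (simp_all add: oe_nth)

lemma octo_mult_minus: "(- x) \<odot> y = - (x \<odot> y)" "x \<odot> (- y) = - (x \<odot> y)"
  by (simp_all add: vec8_eq mult_comps)

lemma Dij_apply:
  "(Dij 1 2 *v x) $ 0 = 0"
  "(Dij 1 2 *v x) $ 1 = - 4 * x $2"
  "(Dij 1 2 *v x) $ 2 = 4 * x $1"
  "(Dij 1 2 *v x) $ 3 = 0"
  "(Dij 1 2 *v x) $ 4 = 2 * x $7"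
  "(Dij 1 2 *v x) $ 5 = - 2 * x $6"
  "(Dij 1 2 *v x) $ 6 = 2 * x $5"
  "(Dij 1 2 *v x) $ 7 = - 2 * x $4"
  "(Dij 1 3 *v x) $ 0 = 0"
  "(Dij 1 3 *v x) $ 1 = - 4 * x $3"
  "(Dij 1 3 *v x) $ 2 = 0"
  "(Dij 1 3 *v x) $ 3 = 4 * x $1"
  "(Dij 1 3 *v x) $ 4 = - 2 * x $6"
  "(Dij 1 3 *v x) $ 5 = - 2 * x $7"
  "(Dij 1 3 *v x) $ 6 = 2 * x $4"
  "(Dij 1 3 *v x) $ 7 = 2 * x $5"
  "(Dij 2 3 *v x) $ 0 = 0"
  "(Dij 2 3 *v x) $ 1 = 0"
  "(Dij 2 3 *v x) $ 2 = - 4 * x $3"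
  "(Dij 2 3 *v x) $ 3 = 4 * x $2"
  "(Dij 2 3 *v x) $ 4 = 2 * x $5"
  "(Dij 2 3 *v x) $ 5 = - 2 * x $4"
  "(Dij 2 3 *v x) $ 6 = - 2 * x $7"
  "(Dij 2 3 *v x) $ 7 = 2 * x $6"
  "(Dij 4 5 *v x) $ 0 = 0"
  "(Dij 4 5 *v x) $ 1 = 0"
  "(Dij 4 5 *v x) $ 2 = 2 * x $3"
  "(Dij 4 5 *v x) $ 3 = - 2 * x $2"
  "(Dij 4 5 *v x) $ 4 = - 4 * x $5"
  "(Dij 4 5 *v x) $ 5 = 4 * x $4"
  "(Dij 4 5 *v x) $ 6 = - 2 * x $7"
  "(Dij 4 5 *v x) $ 7 = 2 * x $6"
  "(Dij 4 6 *v x) $ 0 = 0"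
  "(Dij 4 6 *v x) $ 1 = - 2 * x $3"
  "(Dij 4 6 *v x) $ 2 = 0"
  "(Dij 4 6 *v x) $ 3 = 2 * x $1"
  "(Dij 4 6 *v x) $ 4 = - 4 * x $6"
  "(Dij 4 6 *v x) $ 5 = 2 * x $7"
  "(Dij 4 6 *v x) $ 6 = 4 * x $4"
  "(Dij 4 6 *v x) $ 7 = - 2 * x $5"
  "(Dij 4 7 *v x) $ 0 = 0"
  "(Dij 4 7 *v x) $ 1 = 2 * x $2"
  "(Dij 4 7 *v x) $ 2 = - 2 * x $1"
  "(Dij 4 7 *v x) $ 3 = 0"
  "(Dij 4 7 *v x) $ 4 = - 4 * x $7"
  "(Dij 4 7 *v x) $ 5 = - 2 * x $6"
  "(Dij 4 7 *v x) $ 6 = 2 * x $5"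
  "(Dij 4 7 *v x) $ 7 = 4 * x $4"
  by (simp_all add: Dij_def octo_der_apply octo_commutator_def octo_associator_def
      oe_mult_oe octo_mult_linear octo_mult_minus oe_mult_rows)
     (simp_all add: mult_comps oe_nth)

lemma HA_iff: "x \<in> HA \<longleftrightarrow> x $ 4 = 0 \<and> x $ 5 = 0 \<and> x $ 6 = 0 \<and> x $ 7 = 0"
proof -
  have "x = x $ 0 *\<^sub>R oe 0 + x $ 1 *\<^sub>R oe 1 + x $ 2 *\<^sub>R oe 2 + x $ 3 *\<^sub>R oe 3"
    if "x $ 4 = 0 \<and> x $ 5 = 0 \<and> x $ 6 = 0 \<and> x $ 7 = 0"
    using that by (simp add: vec8_eq oe_nth)
  then show ?thesis
    unfolding HA_def
    by (auto simp: span_insert span_empty oe_nth vec8_eq algebra_simps intro: exI[of _ "x$0"] exI[of _ "x$1"])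
qed

lemma Dij_kA: "Dij 1 2 \<in> kA" "Dij 1 3 \<in> kA" "Dij 2 3 \<in> kA" "Dij 4 5 \<in> kA" "Dij 4 6 \<in> kA" "Dij 4 7 \<in> kA"
  by (simp_all add: kA_def g2_def vec8_eq mult_comps Dij_apply image_subset_iff HA_iff algebra_simps)

lemma subspace_kA: "subspace kA"
  by (simp add: subspace_def kA_def g2_def image_subset_iff HA_iff octo_mult_linear
      matrix_vector_mult_add_rdistrib scaleR_matrix_vector_assoc[symmetric] algebra_simps)

lemma lie_subalgebra_g2: "lie_subalgebra g2"
  unfolding lie_subalgebra_def subspace_def g2_def lie_bracket_def
  by (auto simp: octo_mult_linear matrix_vector_mult_add_rdistrib matrix_vector_mult_diff_rdistrib
      scaleR_matrix_vector_assoc[symmetric] matrix_vector_mul_assoc[symmetric] algebra_simps)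

lemma Z_in_kA:
  "x0 *\<^sub>R Dij 1 2 + x1 *\<^sub>R Dij 1 3 + x2 *\<^sub>R Dij 2 3
   + x3 *\<^sub>R Dij 4 5 + x4 *\<^sub>R Dij 4 6 + x5 *\<^sub>R Dij 4 7 \<in> kA"
  by (intro subspace_add subspace_scale subspace_kA Dij_kA)

end

theory Submission
  imports Defs
begin

text \<open>
  Put \<open>U = Z\<close>, \<open>W = Ad_S Z\<close> and \<open>T = [U, W]\<close>. All three matrices are skew, so \<open>T\<close> is orthogonal to \<open>U\<close> and
  \<open>W\<close> for the trace form; if \<open>T \<noteq> 0\<close>, the dimension is at least three, and it equals three iff
  \<open>[U, T] = \<alpha> U + \<beta> W\<close> for some \<open>\<alpha>\<close>, \<open>\<beta>\<close> (the relation for \<open>[W, T]\<close> follows by applying \<open>Ad_S\<close>). An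
  element of \<open>g2\<close> is determined by its values at \<open>e_1\<close>, \<open>e_2\<close>, \<open>e_4\<close>. Comparing these values forces
  \<open>a_1 = b_1 = 0\<close>, and then leaves
  \<open>(7|q|^2 + 3|p|^2 + \<beta>) q + 6 cnj(q)^2 p = 0\<close> and \<open>6 q^3 + (9|q|^2 + |p|^2 + \<beta>) p = 0\<close>.
  For \<open>q \<noteq> 0\<close> the first equation says \<open>|q|^2 p = \<eta> q^3\<close> with \<open>\<eta>\<close> real, and the second one becomes
  \<open>(\<eta> - 1)(\<eta> + 1)(\<eta> + 3) = 0\<close>. Since \<open>\<beta> |W|^2 = - |T|^2 < 0\<close>, the algebra is \<open>su(2)\<close>.
\<close>

section \<open>Lie algebras generated by two skew-symmetric matrices\<close>

lemma lie_bracket_apply: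
  fixes X Y :: "real ^ 'n ^ 'n"
  shows "lie_bracket X Y *v v = X *v (Y *v v) - Y *v (X *v v)"
  by (simp add: lie_bracket_def matrix_vector_mult_diff_rdistrib matrix_vector_mul_assoc)

lemma scaleR_matrix_mult_left:
  fixes A B :: "'a::real_algebra_1 ^ 'n ^ 'n"
  shows "(c *\<^sub>R A) ** B = c *\<^sub>R (A ** B)"
  by (simp add: matrix_matrix_mult_def vec_eq_iff scaleR_sum_right)

lemma scaleR_matrix_mult_right:
  fixes A B :: "'a::real_algebra_1 ^ 'n ^ 'n"
  shows "A ** (c *\<^sub>R B) = c *\<^sub>R (A ** B)"
  by (simp add: matrix_matrix_mult_def vec_eq_iff scaleR_sum_right)

lemma matrix_mult_distrib:
  fixes A B C :: "'a::real_algebra_1 ^ 'n ^ 'n"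
  shows "(A + B) ** C = A ** C + B ** C" "A ** (B + C) = A ** B + A ** C"
    "(A - B) ** C = A ** C - B ** C" "A ** (B - C) = A ** B - A ** C"
  by (simp_all add: matrix_matrix_mult_def vec_eq_iff sum.distrib sum_subtractf algebra_simps)

lemma lie_bracket_linear:
  fixes X Y Z :: "'a::real_algebra_1 ^ 'n ^ 'n"
  shows "lie_bracket (X + Y) Z = lie_bracket X Z + lie_bracket Y Z"
    "lie_bracket X (Y + Z) = lie_bracket X Y + lie_bracket X Z"
    "lie_bracket (c *\<^sub>R X) Y = c *\<^sub>R lie_bracket X Y"
    "lie_bracket X (c *\<^sub>R Y) = c *\<^sub>R lie_bracket X Y"
  by (simp_all add: lie_bracket_def matrix_mult_distrib scaleR_matrix_mult_left
      scaleR_matrix_mult_right algebra_simps)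

lemma lie_bracket_self [simp]: "lie_bracket X X = 0"
  by (simp add: lie_bracket_def)

lemma lie_bracket_zero [simp]:
  fixes X :: "'a::real_algebra_1 ^ 'n ^ 'n"
  shows "lie_bracket 0 X = 0" "lie_bracket X 0 = 0"
  by (simp_all add: lie_bracket_def matrix_matrix_mult_def vec_eq_iff)

lemma lie_bracket_commute: "lie_bracket Y X = - lie_bracket X Y"
  by (simp add: lie_bracket_def)

section \<open>Skew matrices and the trace form\<close>

definition skew :: "real ^ 'n ^ 'n \<Rightarrow> bool" where
  "skew A \<longleftrightarrow> transpose A = - A"

lemma skewI:
  fixes A :: "real ^ 'n ^ 'n"
  assumes "\<And>x y. x \<bullet> (A *v y) = - ((A *v x) \<bullet> y)"
  shows "skew A"
proof -
  have "A $ i $ j = - (A $ j $ i)" for i j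
    using assms[of "axis i 1" "axis j 1"]
    by (simp add: matrix_vector_mul_component inner_axis inner_axis' inner_commute column_def flip: matrix_vector_mult_basis)
  then show ?thesis
    unfolding skew_def transpose_def vec_eq_iff vec_lambda_beta vector_uminus_component by metis
qed

text \<open>The inner product on \<open>real ^ 'n ^ 'n\<close> is the trace form, and for it left
  multiplication by \<open>A\<close> has left multiplication by \<open>transpose A\<close> as its
  adjoint. The proof reorders a triple sum.\<close>

lemma inner_matrix_mult_left:
  fixes A X Y :: "real ^ 'n ^ 'n"
  shows "(A ** X) \<bullet> Y = X \<bullet> (transpose A ** Y)"
proof -
  have "(A ** X) \<bullet> Y = (\<Sum>i\<in>UNIV. \<Sum>j\<in>UNIV. \<Sum>k\<in>UNIV. A $ i $ k * X $ k $ j * Y $ i $ j)"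
    by (simp add: inner_vec_def matrix_matrix_mult_def sum_distrib_right)
  also have "\<dots> = (\<Sum>i\<in>UNIV. \<Sum>k\<in>UNIV. \<Sum>j\<in>UNIV. A $ i $ k * X $ k $ j * Y $ i $ j)"
    by (rule sum.cong[OF refl], rule sum.swap)
  also have "\<dots> = (\<Sum>k\<in>UNIV. \<Sum>i\<in>UNIV. \<Sum>j\<in>UNIV. A $ i $ k * X $ k $ j * Y $ i $ j)"
    by (rule sum.swap)
  also have "\<dots> = (\<Sum>k\<in>UNIV. \<Sum>j\<in>UNIV. \<Sum>i\<in>UNIV. A $ i $ k * X $ k $ j * Y $ i $ j)"
    by (rule sum.cong[OF refl], rule sum.swap)
  also have "\<dots> = X \<bullet> (transpose A ** Y)"
    by (simp add: inner_vec_def matrix_matrix_mult_def transpose_def sum_distrib_left mult_ac)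
  finally show ?thesis .
qed

lemma inner_transpose:
  fixes X Y :: "real ^ 'n ^ 'm"
  shows "transpose X \<bullet> transpose Y = X \<bullet> Y"
  unfolding inner_vec_def transpose_def by simp (rule sum.swap)

lemma inner_matrix_mult_right:
  fixes A X Y :: "real ^ 'n ^ 'n"
  shows "(X ** A) \<bullet> Y = X \<bullet> (Y ** transpose A)"
  using inner_matrix_mult_left[of "transpose A" "transpose X" "transpose Y"]
  by (metis inner_transpose matrix_transpose_mul transpose_transpose)

text \<open>Both one-sided multiplications by a skew \<open>A\<close> have multiplication by
  \<open>- A\<close> as adjoint, so ad \<open>A\<close> is skew for the trace form.\<close>

lemma inner_lie_bracket:
  fixes A X Y :: "real ^ 'n ^ 'n"
  assumes "skew A"
  shows "lie_bracket A X \<bullet> Y = - (X \<bullet> lie_bracket A Y)"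
proof -
  have "(- A) ** Y = - (A ** Y)" "Y ** (- A) = - (Y ** A)"
    using scaleR_matrix_mult_left[of "-1" A Y] scaleR_matrix_mult_right[of Y "-1" A] by simp_all
  then show ?thesis
    using assms
    by (simp add: lie_bracket_def inner_diff_left inner_diff_right inner_matrix_mult_left[of A]
        inner_matrix_mult_right[of _ A] skew_def)
qed

lemma span3_iff:
  "x \<in> span {u, v, w} \<longleftrightarrow> (\<exists>a b c. x = a *\<^sub>R u + b *\<^sub>R v + c *\<^sub>R w)"
proof -
  have "x - a *\<^sub>R u - b *\<^sub>R v = c *\<^sub>R w \<longleftrightarrow> x = a *\<^sub>R u + b *\<^sub>R v + c *\<^sub>R w" for a b c
    by (auto simp: algebra_simps)
  then show ?thesis
    by (simp add: span_insert span_empty)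
qed

lemma span2_iff:
  "x \<in> span {u, v} \<longleftrightarrow> (\<exists>a b. x = a *\<^sub>R u + b *\<^sub>R v)"
proof -
  have "x - a *\<^sub>R u = b *\<^sub>R v \<longleftrightarrow> x = a *\<^sub>R u + b *\<^sub>R v" for a b
    by (auto simp: algebra_simps)
  then show ?thesis
    by (simp add: span_insert span_empty)
qed

text \<open>Moving ad \<open>U\<close> or ad \<open>W\<close> across the inner product leaves the
  bracket of a matrix with itself, so \<open>[U, W]\<close> is orthogonal to both. A dependence
  between \<open>U\<close> and \<open>W\<close> would make the bracket vanish. The cardinality is
  recorded because a set hides repeated elements.\<close>

lemma independent_lie_bracket:
  fixes U W :: "real ^ 'n ^ 'n"
  assumes skew: "skew U" "skew W" and nz: "lie_bracket U W \<noteq> 0"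
  shows "independent {U, W, lie_bracket U W}" "card {U, W, lie_bracket U W} = 3"
proof -
  let ?T = "lie_bracket U W"
  have perpU: "?T \<bullet> U = 0"
    using inner_lie_bracket[OF skew(1), of W U] by simp
  have perpW: "?T \<bullet> W = 0"
    using inner_lie_bracket[OF skew(2), of U W] lie_bracket_commute[of W U] by simp
  have "?T \<notin> span {U, W}"
  proof
    assume "?T \<in> span {U, W}"
    then obtain a b where "?T = a *\<^sub>R U + b *\<^sub>R W" by (auto simp: span2_iff)
    then have "?T \<bullet> ?T = 0"
      by (metis perpU perpW inner_add_right inner_scaleR_right mult_zero_right add_0)
    with nz show False by simp
  qed
  moreover have "U \<notin> span {W}"
    using nz by (auto simp: span_singleton lie_bracket_linear)
  moreover have "W \<noteq> 0" using nz by auto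
  ultimately have "independent {?T, U, W}" and d: "?T \<notin> {U, W}" "U \<noteq> W"
    by (auto simp: independent_insert span_base)
  then show "independent {U, W, ?T}" by (simp add: insert_commute)
  show "card {U, W, ?T} = 3" using d by (auto simp: card_insert_if)
qed

section \<open>The Lie subalgebra generated by two matrices\<close>

lemma lie_generated_base: "U \<in> lie_generated U W" "W \<in> lie_generated U W"
  using hull_subset[of "{U, W}" lie_subalgebra] by (auto simp: lie_generated_def)

lemma lie_subalgebra_generated: "lie_subalgebra (lie_generated U W)"
  unfolding lie_generated_def
  by (rule hull_in) (auto simp: lie_subalgebra_def subspace_def)

lemma lie_bracket_in_generated:
  "X \<in> lie_generated U W \<Longrightarrow> Y \<in> lie_generated U W \<Longrightarrow> lie_bracket X Y \<in> lie_generated U W"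
  using lie_subalgebra_generated[of U W] by (auto simp: lie_subalgebra_def)

lemma subspace_lie_generated: "subspace (lie_generated U W)"
  using lie_subalgebra_generated[of U W] by (auto simp: lie_subalgebra_def)

lemma lie_generated_minimal:
  "lie_subalgebra M \<Longrightarrow> U \<in> M \<Longrightarrow> W \<in> M \<Longrightarrow> lie_generated U W \<subseteq> M"
  unfolding lie_generated_def by (rule hull_minimal) auto

text \<open>By bilinearity the brackets of elements of \<open>B\<close> control all brackets in
  \<open>span B\<close>; one induction extends the left argument, a second one the right
  argument.\<close>

lemma lie_generated_eq_span:
  fixes U W :: "'a::real_algebra_1 ^ 'n ^ 'n"
  assumes "U \<in> span B" "W \<in> span B" "B \<subseteq> lie_generated U W"
    and closed: "\<And>X Y. X \<in> B \<Longrightarrow> Y \<in> B \<Longrightarrow> lie_bracket X Y \<in> span B"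
  shows "lie_generated U W = span B"
proof
  have l: "lie_bracket X Y \<in> span B" if "X \<in> span B" "Y \<in> B" for X Y
    using that(1)
  proof (induction rule: span_induct_alt)
    case base
    show ?case by (simp add: span_zero)
  next
    case (step c x y)
    then show ?case
      using closed[OF _ that(2)] by (auto simp: lie_bracket_linear intro!: span_add span_scale)
  qed
  have "lie_bracket X Y \<in> span B" if "X \<in> span B" "Y \<in> span B" for X Y
    using that(2)
  proof (induction rule: span_induct_alt)
    case base
    show ?case by (simp add: span_zero)
  next
    case (step c x y)
    then show ?case
      using l[OF that(1)] by (auto simp: lie_bracket_linear intro!: span_add span_scale)
  qed
  then have "lie_subalgebra (span B)" by (simp add: lie_subalgebra_def)
  then show "lie_generated U W \<subseteq> span B"
    using assms by (intro lie_generated_minimal)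
  show "span B \<subseteq> lie_generated U W"
    using assms subspace_lie_generated by (intro span_minimal)
qed

lemma lie_generated_commuting:
  fixes U W :: "'a::real_algebra_1 ^ 'n ^ 'n"
  assumes "lie_bracket U W = 0"
  shows "lie_generated U W = span {U, W}"
proof (rule lie_generated_eq_span)
  show "lie_bracket X Y \<in> span {U, W}" if "X \<in> {U, W}" "Y \<in> {U, W}" for X Y
    using that assms lie_bracket_commute[of W U] by (auto simp: span_zero)
qed (auto simp: span_base lie_generated_base)

lemma lie_abelian_generated_iff:
  fixes U W :: "'a::real_algebra_1 ^ 'n ^ 'n"
  shows "lie_abelian (lie_generated U W) \<longleftrightarrow> lie_bracket U W = 0"
proof
  assume "lie_abelian (lie_generated U W)"
  then show "lie_bracket U W = 0" by (auto simp: lie_abelian_def lie_generated_base)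
next
  assume c: "lie_bracket U W = 0"
  then have "lie_bracket W U = 0" using lie_bracket_commute[of W U] by simp
  then show "lie_abelian (lie_generated U W)"
    using c by (auto simp: lie_abelian_def lie_generated_commuting[OF c] span2_iff lie_bracket_linear)
qed

lemma lie_generated_three:
  fixes U W :: "'a::real_algebra_1 ^ 'n ^ 'n"
  assumes T: "T = lie_bracket U W"
    and UT: "lie_bracket U T = \<beta> *\<^sub>R W" and WT: "lie_bracket W T = - \<beta> *\<^sub>R U"
  shows "lie_generated U W = span {U, W, T}"
proof (rule lie_generated_eq_span)
  have "lie_bracket W U = - T" "lie_bracket T U = - \<beta> *\<^sub>R W" "lie_bracket T W = \<beta> *\<^sub>R U"
    using T UT WT lie_bracket_commute[of W U] lie_bracket_commute[of T U] lie_bracket_commute[of T W]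
    by simp_all
  then show "lie_bracket X Y \<in> span {U, W, T}" if "X \<in> {U, W, T}" "Y \<in> {U, W, T}" for X Y
    using that UT WT by (auto simp flip: T intro!: span_scale span_neg intro: span_base simp: span_zero)
  show "{U, W, T} \<subseteq> lie_generated U W"
    by (auto simp: T lie_generated_base lie_bracket_in_generated)
qed (auto simp: span_base)

text \<open>Since \<open>ad U\<close> is skew, \<open>[U, T]\<close> is orthogonal to \<open>T\<close>; hence \<open>T\<close> does not occur in the combination.\<close>

lemma lie_generated_dim_le_3D:
  fixes U W :: "real ^ 'n ^ 'n"
  assumes skew: "skew U" "skew W" and T: "T = lie_bracket U W" and nz: "T \<noteq> 0"
    and dim: "dim (lie_generated U W) \<le> 3"
  obtains \<alpha> \<beta> where "lie_bracket U T = \<alpha> *\<^sub>R U + \<beta> *\<^sub>R W"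
proof -
  note indep = independent_lie_bracket[OF skew nz[unfolded T], folded T]
  have sub: "{U, W, T} \<subseteq> lie_generated U W"
    by (auto simp: T lie_generated_base lie_bracket_in_generated)
  \<comment> \<open>Three independent elements span any space of dimension at most three that
    contains them.\<close>
  then have "lie_generated U W \<subseteq> span {U, W, T}"
    using card_ge_dim_independent[OF sub indep(1)] dim indep(2) by simp
  moreover have "lie_bracket U T \<in> lie_generated U W"
    using sub by (intro lie_bracket_in_generated) auto
  ultimately obtain \<alpha> \<beta> \<gamma> where Q: "lie_bracket U T = \<alpha> *\<^sub>R U + \<beta> *\<^sub>R W + \<gamma> *\<^sub>R T"
    using span3_iff by (metis subsetD)
  have "T \<bullet> U = 0"
    unfolding T using inner_lie_bracket[OF skew(1), of W U] by simp
  moreover have "T \<bullet> W = 0"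
    unfolding T using inner_lie_bracket[OF skew(2), of U W] lie_bracket_commute[of W U] by simp
  moreover have "T \<bullet> lie_bracket U T = 0"
    using inner_lie_bracket[OF skew(1), of T T] by (simp add: inner_commute)
  ultimately have "\<gamma> = 0" using nz by (simp add: Q inner_add_right)
  then show ?thesis using that Q by simp
qed

section \<open>The Lie algebra su(2)\<close>

text \<open>The matrices are -i/2 times the three Pauli matrices, normalised so that the structure
  constants are those of the cross product.\<close>

lemma su2_basis:
  obtains A B C :: "complex ^ 2 ^ 2" where
    "lie_bracket A B = C" "lie_bracket A C = - B" "lie_bracket B C = A"
    "su2 = span {A, B, C}"
    "\<forall>a b c. a *\<^sub>R A + b *\<^sub>R B + c *\<^sub>R C = 0 \<longrightarrow> a = 0 \<and> b = 0 \<and> c = 0"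
proof -
  define A :: "complex ^ 2 ^ 2" where "A = (\<chi> i j. if i = j then 0 else - \<i> / 2)"
  define B :: "complex ^ 2 ^ 2" where
    "B = (\<chi> i j. if i = j then 0 else if i = 1 then - 1 / 2 else 1 / 2)"
  define C :: "complex ^ 2 ^ 2" where
    "C = (\<chi> i j. if i \<noteq> j then 0 else if i = 1 then - \<i> / 2 else \<i> / 2)"
  note defs = A_def B_def C_def vec_eq_iff forall_2 sum_2
  show thesis
  proof (rule that[of A B C])
    show "lie_bracket A B = C" "lie_bracket A C = - B" "lie_bracket B C = A"
      by (simp_all add: lie_bracket_def matrix_matrix_mult_def defs)
    show "\<forall>a b c. a *\<^sub>R A + b *\<^sub>R B + c *\<^sub>R C = 0 \<longrightarrow> a = 0 \<and> b = 0 \<and> c = 0"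
      by (simp add: defs complex_eq_iff)
    show "su2 = span {A, B, C}"
    proof (rule set_eqI)
      fix X :: "complex ^ 2 ^ 2"
      have "X = (- 2 * Im (X $ 1 $ 2)) *\<^sub>R A + (- 2 * Re (X $ 1 $ 2)) *\<^sub>R B
              + (- 2 * Im (X $ 1 $ 1)) *\<^sub>R C" if "X \<in> su2"
      proof -
        have adj: "cnj (X $ j $ i) = - (X $ i $ j)" for i j
          using that unfolding su2_def vec_eq_iff by simp
        have tr: "X $ 1 $ 1 + X $ 2 $ 2 = 0"
          using that by (simp add: su2_def trace_def sum_2)
        have "Re (X $ 1 $ 1) = 0" "Re (X $ 2 $ 2) = 0" "Re (X $ 2 $ 1) = - Re (X $ 1 $ 2)"
          "Im (X $ 2 $ 1) = Im (X $ 1 $ 2)" "Im (X $ 2 $ 2) = - Im (X $ 1 $ 1)"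
          using arg_cong[OF adj[of 1 1], of Re] arg_cong[OF adj[of 2 2], of Re]
            arg_cong[OF adj[of 1 2], of Re] arg_cong[OF adj[of 1 2], of Im] arg_cong[OF tr, of Im]
          by simp_all
        then show ?thesis by (simp add: defs complex_eq_iff)
      qed
      moreover have "a *\<^sub>R A + b *\<^sub>R B + c *\<^sub>R C \<in> su2" for a b c
        by (simp add: su2_def trace_def defs complex_eq_iff)
      ultimately show "X \<in> su2 \<longleftrightarrow> X \<in> span {A, B, C}"
        unfolding span3_iff by metis
    qed
  qed
qed

lemma lie_isomorphic_su2:
  fixes U W :: "real ^ 'n ^ 'n"
  assumes T: "T = lie_bracket U W"
    and UT: "lie_bracket U T = - (\<kappa>\<^sup>2) *\<^sub>R W" and WT: "lie_bracket W T = \<kappa>\<^sup>2 *\<^sub>R U"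
    and \<kappa>: "\<kappa> \<noteq> 0" and indep: "independent {U, W, T}" "card {U, W, T} = 3"
  shows "lie_isomorphic (span {U, W, T}) su2"
proof -
  obtain A B C :: "complex ^ 2 ^ 2" where
    br: "lie_bracket A B = C" "lie_bracket A C = - B" "lie_bracket B C = A"
    and su2: "su2 = span {A, B, C}"
    and ABC: "\<forall>a b c. a *\<^sub>R A + b *\<^sub>R B + c *\<^sub>R C = 0 \<longrightarrow> a = 0 \<and> b = 0 \<and> c = 0"
    by (rule su2_basis) (rule that)
  have br': "lie_bracket B A = - C" "lie_bracket C A = B" "lie_bracket C B = - A"
    using br lie_bracket_commute[of B A] lie_bracket_commute[of C A] lie_bracket_commute[of C B]
    by simp_all
  have br2: "lie_bracket W U = - T" "lie_bracket T U = \<kappa>\<^sup>2 *\<^sub>R W" "lie_bracket T W = - (\<kappa>\<^sup>2) *\<^sub>R U"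
    using T UT WT lie_bracket_commute[of W U] lie_bracket_commute[of T U] lie_bracket_commute[of T W]
    by simp_all
  have dist: "U \<noteq> W" "U \<noteq> T" "W \<noteq> T"
    using indep(2) by (auto simp: card_insert_if split: if_splits)
  \<comment> \<open>\<open>U\<close> and \<open>W\<close> divided by \<kappa>, and \<open>T\<close>
    divided by the square of \<kappa>, satisfy the relations of \<open>A\<close>, \<open>B\<close>,
    \<open>C\<close>; this dictates the scaling factors.\<close>
  define h where "h X = (if X = U then \<kappa> *\<^sub>R A else if X = W then \<kappa> *\<^sub>R B else \<kappa>\<^sup>2 *\<^sub>R C)" for X
  obtain f where lin: "linear f" and f: "\<And>X. X \<in> {U, W, T} \<Longrightarrow> f X = h X"
    using linear_independent_extend[OF indep(1), of h] by blast
  have fU: "f U = \<kappa> *\<^sub>R A" and fW: "f W = \<kappa> *\<^sub>R B" and fT: "f T = \<kappa>\<^sup>2 *\<^sub>R C"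
    using f[of U] f[of W] f[of T] dist by (auto simp: h_def)
  have comb: "f (a *\<^sub>R U + b *\<^sub>R W + c *\<^sub>R T) = (a * \<kappa>) *\<^sub>R A + (b * \<kappa>) *\<^sub>R B + (c * \<kappa>\<^sup>2) *\<^sub>R C" for a b c
    using lin by (simp add: linear_add linear_scale fU fW fT)
  have inj: "inj_on f (span {U, W, T})"
    unfolding linear_inj_on_iff_eq_0[OF lin subspace_span]
    using comb ABC \<kappa> by (fastforce simp: span3_iff)
  have "f ` span {U, W, T} = su2"
  proof
    show "f ` span {U, W, T} \<subseteq> su2" unfolding su2 span3_iff image_subset_iff by (metis comb span3_iff)
    show "su2 \<subseteq> f ` span {U, W, T}"
    proof
      fix X assume "X \<in> su2"
      then obtain a b c where "X = a *\<^sub>R A + b *\<^sub>R B + c *\<^sub>R C" unfolding su2 span3_iff by blast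
      then have "X = f ((a / \<kappa>) *\<^sub>R U + (b / \<kappa>) *\<^sub>R W + (c / \<kappa>\<^sup>2) *\<^sub>R T)"
        using \<kappa> by (simp only: comb) simp
      then show "X \<in> f ` span {U, W, T}" by (rule image_eqI) (auto simp: span3_iff)
    qed
  qed
  then have "bij_betw f (span {U, W, T}) su2" using inj by (simp add: bij_betw_def)
  moreover have "f (lie_bracket X Y) = lie_bracket (f X) (f Y)"
    if XY: "X \<in> span {U, W, T}" "Y \<in> span {U, W, T}" for X Y
  proof -
    obtain a b c where X: "X = a *\<^sub>R U + b *\<^sub>R W + c *\<^sub>R T" using XY(1) unfolding span3_iff by blast
    obtain a' b' c' where Y: "Y = a' *\<^sub>R U + b' *\<^sub>R W + c' *\<^sub>R T" using XY(2) unfolding span3_iff by blast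
    show ?thesis
      unfolding X Y comb
      by (simp add: lie_bracket_linear linear_add[OF lin] linear_scale[OF lin] linear_neg[OF lin] linear_diff[OF lin]
          UT WT T[symmetric] br br' br2 fU fW fT) (simp add: algebra_simps power2_eq_square)
    qed
  ultimately show ?thesis
    unfolding lie_isomorphic_def using lin by (auto simp: linear_add linear_scale intro!: exI[of _ f])
qed

text \<open>The sign of \<beta> decides the isomorphism type: positive \<beta> would give sl(2,R)
  and \<beta> = 0 the Heisenberg algebra. Pairing \<open>[U, T]\<close> with \<open>W\<close> and
  using that ad \<open>U\<close> is skew excludes both.\<close>

lemma lie_generated_double_bracket:
  fixes U W :: "real ^ 'n ^ 'n"
  assumes skew: "skew U" "skew W" and T: "T = lie_bracket U W" and nz: "T \<noteq> 0"
    and UT: "lie_bracket U T = \<beta> *\<^sub>R W" and WT: "lie_bracket W T = - \<beta> *\<^sub>R U"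
  shows "dim (lie_generated U W) = 3" "lie_isomorphic (lie_generated U W) su2"
proof -
  note indep = independent_lie_bracket[OF skew nz[unfolded T], folded T]
  have L: "lie_generated U W = span {U, W, T}"
    by (rule lie_generated_three[OF T UT WT])
  show "dim (lie_generated U W) = 3"
    using indep by (simp add: L dim_eq_card_independent)
  have "\<beta> * (W \<bullet> W) = - (T \<bullet> T)"
    using inner_lie_bracket[OF skew(1), of T W] by (simp add: UT flip: T)
  then have "\<beta> * (W \<bullet> W) < 0" using nz by simp
  then have "\<beta> < 0" by (simp add: mult_less_0_iff not_less inner_ge_zero leD)
  define \<kappa> where "\<kappa> = sqrt (- \<beta>)"
  have \<beta>: "\<beta> = - (\<kappa>\<^sup>2)" and \<kappa>: "\<kappa> \<noteq> 0" using \<open>\<beta> < 0\<close> by (simp_all add: \<kappa>_def)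
  show "lie_isomorphic (lie_generated U W) su2"
    unfolding L by (rule lie_isomorphic_su2[OF T _ _ \<kappa> indep]) (simp_all add: UT WT \<beta>)
qed

section \<open>Elements of \<open>g2\<close>\<close>

lemma g2_apply_mult: "X \<in> g2 \<Longrightarrow> X *v (x \<odot> y) = (X *v x) \<odot> y + x \<odot> (X *v y)"
  by (simp add: g2_def)

lemma subspace_g2: "subspace g2"
  using lie_subalgebra_g2 by (simp add: lie_subalgebra_def)

lemma lie_bracket_g2: "X \<in> g2 \<Longrightarrow> Y \<in> g2 \<Longrightarrow> lie_bracket X Y \<in> g2"
  using lie_subalgebra_g2 by (simp add: lie_subalgebra_def)

text \<open>The kernel of a derivation is closed under multiplication, and \<open>oe 1\<close>,
  \<open>oe 2\<close>, \<open>oe 4\<close> generate all octonions.\<close>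

lemma g2_zeroI:
  assumes X: "X \<in> g2" and "X *v oe 1 = 0" "X *v oe 2 = 0" "X *v oe 4 = 0"
  shows "X = 0"
proof -
  have prod: "X *v (x \<odot> y) = 0" if "X *v x = 0" "X *v y = 0" for x y
    using that by (simp add: g2_apply_mult[OF X] octo_mult_linear)
  have "oe 1 \<odot> oe 1 = - oe 0" "oe 1 \<odot> oe 4 = oe 5" "oe 2 \<odot> oe 4 = oe 6" "oe 3 \<odot> oe 4 = oe 7"
    by (simp_all add: vec8_eq oe_mult_rows oe_nth)
  then have e: "oe 0 = - (oe 1 \<odot> oe 1)" "oe 3 = oe 1 \<odot> oe 2" "oe 5 = oe 1 \<odot> oe 4"
    "oe 6 = oe 2 \<odot> oe 4" "oe 7 = oe 3 \<odot> oe 4"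
    by (simp_all add: oe_mult_oe)
  have "X *v oe 3 = 0" "X *v oe 5 = 0" "X *v oe 6 = 0" "X *v oe 0 = 0"
    using assms by (simp_all add: e prod vec.neg)
  moreover from this have "X *v oe 7 = 0"
    using assms by (simp add: e(5) prod)
  ultimately have "X *v oe i = 0" for i
    using assms UNIV_index8 by (metis (full_types) UNIV_I empty_iff insert_iff)
  then have "column i X = 0" for i
    by (simp add: oe_def matrix_vector_mult_basis)
  then show ?thesis by (simp add: column_def vec_eq_iff)
qed

lemma g2_eqI:
  assumes "X \<in> g2" "Y \<in> g2" "X *v oe 1 = Y *v oe 1" "X *v oe 2 = Y *v oe 2" "X *v oe 4 = Y *v oe 4"
  shows "X = Y"
proof -
  have "X - Y = 0"
    by (rule g2_zeroI) (use assms subspace_g2 in \<open>auto simp: subspace_diff matrix_vector_mult_diff_rdistrib\<close>)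
  then show ?thesis by simp
qed

section \<open>Conjugation by the involution S\<close>

lemma AdS_eq: "AdS X = Sinvol ** X ** Sinvol"
proof -
  \<comment> \<open>\<open>matrix_inv\<close> is a choice among two-sided inverses;
    \<open>Sinvol\<close> itself witnesses that one exists.\<close>
  have "matrix_inv Sinvol ** Sinvol = mat 1"
    unfolding matrix_inv_def by (rule someI2[of _ Sinvol]) (simp_all add: Sinvol_sq)
  then have left: "matrix_inv Sinvol ** Sinvol ** X = X" for X
    by simp
  have "matrix_inv Sinvol = matrix_inv Sinvol ** (Sinvol ** Sinvol)"
    by (simp add: Sinvol_sq)
  also have "\<dots> = Sinvol"
    by (simp add: matrix_mul_assoc left)
  finally show ?thesis by (simp add: AdS_def)
qed

lemma AdS_apply: "AdS X *v v = Sinvol *v (X *v (Sinvol *v v))"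
  by (simp add: AdS_eq matrix_vector_mul_assoc matrix_mul_assoc)

lemma Sinvol_Sinvol_apply: "Sinvol *v (Sinvol *v v) = v"
  by (simp add: matrix_vector_mul_assoc Sinvol_sq)

lemma AdS_involution: "AdS (AdS X) = X"
  by (simp add: matrix_eq AdS_apply Sinvol_Sinvol_apply)

lemma AdS_lie_bracket: "AdS (lie_bracket X Y) = lie_bracket (AdS X) (AdS Y)"
  by (simp add: matrix_eq AdS_apply lie_bracket_apply Sinvol_Sinvol_apply matrix_vector_mult_diff_distrib)

lemma AdS_linear: "AdS (X + Y) = AdS X + AdS Y" "AdS (c *\<^sub>R X) = c *\<^sub>R AdS X" "AdS (- X) = - AdS X"
proof -
  show add: "AdS (X + Y) = AdS X + AdS Y" and scale: "AdS (c *\<^sub>R X) = c *\<^sub>R AdS X" for c X Y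
    by (simp_all add: AdS_eq matrix_mult_distrib scaleR_matrix_mult_left scaleR_matrix_mult_right)
  show "AdS (- X) = - AdS X" using scale[of "-1" X] by simp
qed

lemma AdS_g2:
  assumes "X \<in> g2"
  shows "AdS X \<in> g2"
proof -
  have S: "Sinvol *v (x \<odot> y) = (Sinvol *v x) \<odot> (Sinvol *v y)" for x y
    using Sinvol_G2 by (simp add: G2_def)
  have "Sinvol *v (x + y) = Sinvol *v x + Sinvol *v y" for x y
    by (rule matrix_vector_right_distrib)
  then show ?thesis
    by (simp add: g2_def AdS_apply S g2_apply_mult[OF assms] Sinvol_Sinvol_apply)
qed

lemma ImO_iff: "w \<in> ImO \<longleftrightarrow> w $ 0 = 0"
proof
  have "subspace {w :: octo. w $ 0 = 0}" by (simp add: subspace_def)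
  moreover have "oe ` {i. i \<noteq> 0} \<subseteq> {w. w $ 0 = 0}" by (auto simp: oe_nth)
  ultimately show "w \<in> ImO \<Longrightarrow> w $ 0 = 0"
    unfolding ImO_def using span_minimal by blast
next
  assume "w $ 0 = 0"
  then have "w = w$1 *\<^sub>R oe 1 + w$2 *\<^sub>R oe 2 + w$3 *\<^sub>R oe 3 + w$4 *\<^sub>R oe 4 + w$5 *\<^sub>R oe 5
      + w$6 *\<^sub>R oe 6 + w$7 *\<^sub>R oe 7"
    by (simp add: vec8_eq oe_nth)
  moreover have "\<dots> \<in> ImO"
    unfolding ImO_def by (intro span_add span_scale span_base) auto
  ultimately show "w \<in> ImO" by simp
qed

section \<open>The pair \<open>Z\<close>, \<open>Ad_S Z\<close>\<close>

locale kA_element =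
  fixes a1 a2 a3 b1 b2 b3 :: real
begin

text \<open>The coefficients invert the linear change of coordinates from the \<open>x\<close> to
  the \<open>a\<close> and \<open>b\<close>, so arbitrary parameters of the locale describe every
  \<open>Z\<close>.\<close>

definition U :: "real ^ 8 ^ 8" where
  "U = ((a3 + b3 / 3) / 2) *\<^sub>R Dij 1 2 + (- (a2 + b2 / 3) / 2) *\<^sub>R Dij 1 3 + ((a1 + b1 / 3) / 2) *\<^sub>R Dij 2 3
     + (b1 / 3) *\<^sub>R Dij 4 5 + (b2 / 3) *\<^sub>R Dij 4 6 + (b3 / 3) *\<^sub>R Dij 4 7"

definition W :: "real ^ 8 ^ 8" where "W = AdS U"

definition T :: "real ^ 8 ^ 8" where "T = lie_bracket U W"

definition q :: complex where "q = Complex a2 a3"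

definition p :: complex where "p = Complex b2 b3"

text \<open>The coordinates separate the two commuting su(2) factors of so(4). On
  \<open>oe 1\<close>, \<open>oe 2\<close>, \<open>oe 3\<close> only the vector a acts, as twice the
  cross product with a; on \<open>oe 4\<close> to \<open>oe 7\<close> the parts of a and b are the
  two commuting halves, of opposite duality, of a skew 4 by 4 matrix.\<close>

lemma U_apply:
  "(U *v x) $ 0 = 0"
  "(U *v x) $ 1 = - 2 * a3 * x$2 + 2 * a2 * x$3"
  "(U *v x) $ 2 = 2 * a3 * x$1 - 2 * a1 * x$3"
  "(U *v x) $ 3 = - 2 * a2 * x$1 + 2 * a1 * x$2"
  "(U *v x) $ 4 = (a1 - b1) * x$5 + (a2 - b2) * x$6 + (a3 - b3) * x$7"
  "(U *v x) $ 5 = - (a1 - b1) * x$4 - (a3 + b3) * x$6 + (a2 + b2) * x$7"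
  "(U *v x) $ 6 = - (a2 - b2) * x$4 + (a3 + b3) * x$5 - (a1 + b1) * x$7"
  "(U *v x) $ 7 = - (a3 - b3) * x$4 - (a2 + b2) * x$5 + (a1 + b1) * x$6"
  unfolding U_def matrix_vector_mult_add_rdistrib scaleR_matrix_vector_assoc[symmetric]
    vector_add_component vector_scaleR_component Dij_apply
  by (simp_all add: field_simps)

lemma W_apply:
  "(W *v x) $ 0 = 0"
  "(W *v x) $ 1 = - 2 * a3 * x$4 + 2 * a2 * x$5"
  "(W *v x) $ 2 = (a1 - b1) * x$3 - (a2 - b2) * x$6 - (a3 - b3) * x$7"
  "(W *v x) $ 3 = - (a1 - b1) * x$2 + (a3 + b3) * x$6 - (a2 + b2) * x$7"
  "(W *v x) $ 4 = 2 * a3 * x$1 - 2 * a1 * x$5"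
  "(W *v x) $ 5 = - 2 * a2 * x$1 + 2 * a1 * x$4"
  "(W *v x) $ 6 = (a2 - b2) * x$2 - (a3 + b3) * x$3 - (a1 + b1) * x$7"
  "(W *v x) $ 7 = (a3 - b3) * x$2 + (a2 + b2) * x$3 + (a1 + b1) * x$6"
  by (simp_all add: W_def AdS_apply Sinvol_apply U_apply algebra_simps)

lemma U_g2: "U \<in> g2"
  using Z_in_kA unfolding U_def kA_def by blast

lemma W_g2: "W \<in> g2"
  unfolding W_def by (rule AdS_g2[OF U_g2])

lemma T_g2: "T \<in> g2"
  unfolding T_def by (rule lie_bracket_g2[OF U_g2 W_g2])

lemma skew_U: "skew U"
  by (rule skewI) (simp add: inner_vec_def sum_index8 U_apply algebra_simps)

lemma skew_W: "skew W"
  by (rule skewI) (simp add: inner_vec_def sum_index8 W_apply algebra_simps)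

lemma T_apply: "T *v x = U *v (W *v x) - W *v (U *v x)"
  by (simp add: T_def lie_bracket_apply)

lemma T_eq_0_iff: "T = 0 \<longleftrightarrow> q = 0 \<and> p = 0"
proof
  assume "T = 0"
  \<comment> \<open>The second entry is a sum of squares and forces \<open>a3 = 0\<close>,
    \<open>b2 = a2\<close> and \<open>b3 = a3\<close>; the first one then reduces to a multiple of
    the square of \<open>a2\<close>.\<close>
  then have "(T *v oe 1) $ 7 = 0" "(T *v oe 2) $ 4 = 0" by simp_all
  then have *: "a2\<^sup>2 + a2 * b2 - a3\<^sup>2 + a3 * b3 = 0"
    and "(a2 - b2)\<^sup>2 + (a3 - b3)\<^sup>2 + 4 * a3\<^sup>2 = 0"
    by (simp_all add: T_apply U_apply W_apply oe_nth power2_eq_square algebra_simps)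
  then have "(a2 - b2)\<^sup>2 = 0" "(a3 - b3)\<^sup>2 = 0" "a3\<^sup>2 = 0"
    using zero_le_power2[of "a2 - b2"] zero_le_power2[of "a3 - b3"] zero_le_power2[of a3] by linarith+
  then have "b2 = a2" "b3 = a3" "a3 = 0" by simp_all
  then show "q = 0 \<and> p = 0"
    using * unfolding q_def p_def complex_eq_iff by (simp add: power2_eq_square)
next
  assume "q = 0 \<and> p = 0"
  then have "a2 = 0" "a3 = 0" "b2 = 0" "b3 = 0" by (simp_all add: q_def p_def complex_eq_iff)
  then show "T = 0"
    by (intro g2_zeroI[OF T_g2]; unfold vec8_eq T_apply vector_minus_component U_apply W_apply oe_nth)
       (simp_all add: algebra_simps)
qed

text \<open>\<open>AdS\<close> exchanges \<open>U\<close> and \<open>W\<close>, hence negates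
  \<open>T\<close>, and carries the first relation to the second.\<close>

lemma double_bracket_W:
  assumes UT: "lie_bracket U T = \<beta> *\<^sub>R W"
  shows "lie_bracket W T = - \<beta> *\<^sub>R U"
proof -
  have W: "AdS W = U" by (simp add: W_def AdS_involution)
  have T: "AdS T = - T"
    using lie_bracket_commute[of W U] by (simp add: T_def AdS_lie_bracket W flip: W_def)
  have "lie_bracket W (- T) = \<beta> *\<^sub>R U"
    using arg_cong[OF UT, of AdS] by (simp add: AdS_lie_bracket AdS_linear W T flip: W_def)
  then show ?thesis
    using lie_bracket_linear(4)[of W "-1" T] by (simp add: minus_equation_iff)
qed

text \<open>These are the three columns that \<open>g2_eqI\<close> compares, expanded as cubic
  polynomials in the coordinates.\<close>

lemma double_bracket_columns:
  "(lie_bracket U T *v oe 1) $ 0 = 0"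
  "(lie_bracket U T *v oe 1) $ 1 = 0"
  "(lie_bracket U T *v oe 1) $ 2 = - 4 * a1^2 * a3 + 4 * a1 * a3 * b1"
  "(lie_bracket U T *v oe 1) $ 3 = 4 * a1^2 * a2 - 4 * a1 * a2 * b1"
  "(lie_bracket U T *v oe 1) $ 4 = - 2 * a1^2 * a3 + 4 * a1 * a3 * b1 - 14 * a2^2 * a3 - 12 * a2^2 *
     b3 + 24 * a2 * a3 * b2 - 14 * a3^3 + 12 * a3^2 * b3 - 2 * a3 * b1^2 - 6 * a3 * b2^2 - 6 * a3 *
     b3^2"
  "(lie_bracket U T *v oe 1) $ 5 = 2 * a1^2 * a2 - 4 * a1 * a2 * b1 + 14 * a2^3 + 12 * a2^2 * b2 +
     14 * a2 * a3^2 + 24 * a2 * a3 * b3 + 2 * a2 * b1^2 + 6 * a2 * b2^2 + 6 * a2 * b3^2 - 12 * a3^2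
     * b2"
  "(lie_bracket U T *v oe 1) $ 6 = - 12 * a1 * a2 * b2 - 12 * a1 * a3 * b3 - 8 * a2^2 * b1 - 4 * a2
     * b1 * b2 + 8 * a3^2 * b1 - 4 * a3 * b1 * b3"
  "(lie_bracket U T *v oe 1) $ 7 = - 12 * a1 * a2 * b3 + 12 * a1 * a3 * b2 - 16 * a2 * a3 * b1 - 4 *
     a2 * b1 * b3 + 4 * a3 * b1 * b2"
  "(lie_bracket U T *v oe 2) $ 0 = 0"
  "(lie_bracket U T *v oe 2) $ 1 = 4 * a1^2 * a3 - 4 * a1 * a3 * b1"
  "(lie_bracket U T *v oe 2) $ 2 = 0"
  "(lie_bracket U T *v oe 2) $ 3 = 4 * a1 * a2^2 + 4 * a1 * a3^2 - 4 * a2^2 * b1 - 4 * a3^2 * b1"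
  "(lie_bracket U T *v oe 2) $ 4 = 6 * a1 * a2 * b3 - 6 * a1 * a3 * b2 + 8 * a2 * a3 * b1 + 2 * a2 *
     b1 * b3 - 2 * a3 * b1 * b2"
  "(lie_bracket U T *v oe 2) $ 5 = - 12 * a1 * a2^2 - 6 * a1 * a2 * b2 - 12 * a1 * a3^2 - 6 * a1 *
     a3 * b3 - 6 * a1 * b2^2 - 6 * a1 * b3^2 + 2 * a2^2 * b1 - 2 * a2 * b1 * b2 + 10 * a3^2 * b1 - 2
     * a3 * b1 * b3"
  "(lie_bracket U T *v oe 2) $ 6 = - (a1^2 * a2) + 9 * a1^2 * b2 + 2 * a1 * a2 * b1 + 6 * a1 * b1 *
     b2 - a2^3 + 3 * a2^2 * b2 - 25 * a2 * a3^2 - 12 * a2 * a3 * b3 - a2 * b1^2 - 3 * a2 * b2^2 - 3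
     * a2 * b3^2 + 15 * a3^2 * b2 + b1^2 * b2 + b2^3 + b2 * b3^2"
  "(lie_bracket U T *v oe 2) $ 7 = - (a1^2 * a3) + 9 * a1^2 * b3 + 2 * a1 * a3 * b1 + 6 * a1 * b1 *
     b3 + 11 * a2^2 * a3 + 3 * a2^2 * b3 + 12 * a2 * a3 * b2 - 13 * a3^3 + 15 * a3^2 * b3 - a3 *
     b1^2 - 3 * a3 * b2^2 - 3 * a3 * b3^2 + b1^2 * b3 + b2^2 * b3 + b3^3"
  "(lie_bracket U T *v oe 4) $ 0 = 0"
  "(lie_bracket U T *v oe 4) $ 1 = 2 * a1^2 * a3 - 4 * a1 * a3 * b1 + 14 * a2^2 * a3 + 12 * a2^2 *
     b3 - 24 * a2 * a3 * b2 + 14 * a3^3 - 12 * a3^2 * b3 + 2 * a3 * b1^2 + 6 * a3 * b2^2 + 6 * a3 *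
     b3^2"
  "(lie_bracket U T *v oe 4) $ 2 = - 6 * a1 * a2 * b3 + 6 * a1 * a3 * b2 - 8 * a2 * a3 * b1 - 2 * a2
     * b1 * b3 + 2 * a3 * b1 * b2"
  "(lie_bracket U T *v oe 4) $ 3 = - 12 * a1 * a2^2 + 6 * a1 * a2 * b2 - 12 * a1 * a3^2 + 6 * a1 *
     a3 * b3 - 6 * a1 * b2^2 - 6 * a1 * b3^2 + 10 * a2^2 * b1 + 2 * a2 * b1 * b2 + 2 * a3^2 * b1 + 2
     * a3 * b1 * b3"
  "(lie_bracket U T *v oe 4) $ 4 = 0"
  "(lie_bracket U T *v oe 4) $ 5 = - 2 * a1 * a2^2 - 2 * a1 * a3^2 - 6 * a1 * b2^2 - 6 * a1 * b3^2 +
     2 * a2^2 * b1 + 2 * a3^2 * b1 - 2 * b1 * b2^2 - 2 * b1 * b3^2"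
  "(lie_bracket U T *v oe 4) $ 6 = 2 * a1^2 * a2 - 2 * a1 * a2 * b1 + 6 * a1 * b1 * b2 + 2 * b1^2 *
     b2"
  "(lie_bracket U T *v oe 4) $ 7 = 2 * a1^2 * a3 - 2 * a1 * a3 * b1 + 6 * a1 * b1 * b3 + 2 * b1^2 *
     b3"
  by (simp_all add: lie_bracket_apply T_apply U_apply W_apply oe_nth)
     (simp_all add: algebra_simps power2_eq_square power3_eq_cube)

text \<open>
  Conjugation by the one-parameter group of \<open>D_23 + D_45\<close>, which commutes with \<open>Ad_S\<close>, rotates
  \<open>q\<close> and \<open>p\<close> with weights one and three. The two equations are the parts of weight one and three
  of \<open>[U, [U, W]] = \<beta> W\<close> when \<open>a1 = b1 = 0\<close>.
\<close>

definition balanced :: "real \<Rightarrow> bool" where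
  "balanced \<beta> \<longleftrightarrow>
     of_real (7 * (cmod q)\<^sup>2 + 3 * (cmod p)\<^sup>2 + \<beta>) * q + 6 * (cnj q)\<^sup>2 * p = 0
   \<and> 6 * q ^ 3 + of_real (9 * (cmod q)\<^sup>2 + (cmod p)\<^sup>2 + \<beta>) * p = 0"

lemma balanced_iff:
  "balanced \<beta> \<longleftrightarrow>
     (7 * (a2\<^sup>2 + a3\<^sup>2) + 3 * (b2\<^sup>2 + b3\<^sup>2) + \<beta>) * a2 + 6 * ((a2\<^sup>2 - a3\<^sup>2) * b2 + 2 * a2 * a3 * b3) = 0
   \<and> (7 * (a2\<^sup>2 + a3\<^sup>2) + 3 * (b2\<^sup>2 + b3\<^sup>2) + \<beta>) * a3 + 6 * ((a2\<^sup>2 - a3\<^sup>2) * b3 - 2 * a2 * a3 * b2) = 0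
   \<and> 6 * (a2 ^ 3 - 3 * a2 * a3\<^sup>2) + (9 * (a2\<^sup>2 + a3\<^sup>2) + (b2\<^sup>2 + b3\<^sup>2) + \<beta>) * b2 = 0
   \<and> 6 * (3 * a2\<^sup>2 * a3 - a3 ^ 3) + (9 * (a2\<^sup>2 + a3\<^sup>2) + (b2\<^sup>2 + b3\<^sup>2) + \<beta>) * b3 = 0"
proof -
  have "cmod q ^ 2 = a2\<^sup>2 + a3\<^sup>2" "cmod p ^ 2 = b2\<^sup>2 + b3\<^sup>2"
    by (simp_all add: q_def p_def cmod_power2)
  then show ?thesis
    unfolding balanced_def complex_eq_iff
    by (simp add: q_def p_def power2_eq_square power3_eq_cube) (simp add: algebra_simps)
qed

lemma bracket_of_balanced:
  assumes "a1 = 0" "b1 = 0" "balanced \<beta>"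
  shows "lie_bracket U T = \<beta> *\<^sub>R W"
proof (rule g2_eqI)
  show "lie_bracket U T \<in> g2" "\<beta> *\<^sub>R W \<in> g2"
    by (auto intro: lie_bracket_g2 U_g2 T_g2 subspace_scale subspace_g2 W_g2)
  note bal = assms(3)[unfolded balanced_iff]
  \<comment> \<open>These are the entries that survive when \<open>a1 = b1 = 0\<close>. The first
    two are multiples of the weight one equation; the last two are the weight one equation minus the
    weight three equation.\<close>
  have "\<beta> * (2 * a3) = - 14 * a2^2 * a3 - 12 * a2^2 * b3 + 24 * a2 * a3 * b2 - 14 * a3^3 + 12 * a3^2 * b3
      - 6 * a3 * b2^2 - 6 * a3 * b3^2"
    "\<beta> * (- 2 * a2) = 14 * a2^3 + 12 * a2^2 * b2 + 14 * a2 * a3^2 + 24 * a2 * a3 * b3 + 6 * a2 * b2^2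
      + 6 * a2 * b3^2 - 12 * a3^2 * b2"
    "\<beta> * (a2 - b2) = - (a2^3) + 3 * a2^2 * b2 - 25 * a2 * a3^2 - 12 * a2 * a3 * b3 - 3 * a2 * b2^2
      - 3 * a2 * b3^2 + 15 * a3^2 * b2 + b2^3 + b2 * b3^2"
    "\<beta> * (a3 - b3) = 11 * a2^2 * a3 + 3 * a2^2 * b3 + 12 * a2 * a3 * b2 - 13 * a3^3 + 15 * a3^2 * b3
      - 3 * a3 * b2^2 - 3 * a3 * b3^2 + b2^2 * b3 + b3^3"
    using bal by algebra+
  note eqs = this
  note simps = vec8_eq double_bracket_columns scaleR_matrix_vector_assoc[symmetric]
    vector_scaleR_component W_apply oe_nth
  show "lie_bracket U T *v oe 1 = (\<beta> *\<^sub>R W) *v oe 1"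
    unfolding simps using assms(1,2) eqs by simp
  show "lie_bracket U T *v oe 2 = (\<beta> *\<^sub>R W) *v oe 2"
    unfolding simps using assms(1,2) eqs by simp
  show "lie_bracket U T *v oe 4 = (\<beta> *\<^sub>R W) *v oe 4"
    unfolding simps using assms(1,2) eqs by simp
qed

lemma balanced_of_bracket:
  assumes Q: "lie_bracket U T = \<alpha> *\<^sub>R U + \<beta> *\<^sub>R W" and nz: "\<not> (q = 0 \<and> p = 0)"
  shows "a1 = 0" "b1 = 0" "balanced \<beta>"
proof -
  have col: "(lie_bracket U T *v oe j) $ i = \<alpha> * (U *v oe j) $ i + \<beta> * (W *v oe j) $ i" for i j
    by (simp add: Q matrix_vector_mult_add_rdistrib flip: scaleR_matrix_vector_assoc)
  note eqs = col[of 1 2] col[of 1 3] col[of 1 4] col[of 1 5] col[of 1 6] col[of 1 7] col[of 2 5]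
    col[of 2 6] col[of 2 7] col[of 4 5] col[of 4 6] col[of 4 7]
  note eqs = eqs[unfolded double_bracket_columns U_apply W_apply oe_nth, simplified]
  \<comment> \<open>Here r and s are the squared moduli of \<open>q\<close> and \<open>p\<close>,
    and \<open>c + i d\<close> is \<open>cnj q * p\<close>. \<open>F1\<close> and \<open>F2\<close>
    are the real and imaginary parts of
    \<open>(3 * a1 + b1) * cnj q * p + 2 * b1 * q^2 = 0\<close>.\<close>
  define r where "r = a2\<^sup>2 + a3\<^sup>2"
  define s where "s = b2\<^sup>2 + b3\<^sup>2"
  define c where "c = a2 * b2 + a3 * b3"
  define d where "d = a2 * b3 - a3 * b2"
  have F1: "(3 * a1 + b1) * c + 2 * b1 * (a2\<^sup>2 - a3\<^sup>2) = 0"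
    using eqs(5) unfolding c_def by algebra
  have F2: "(3 * a1 + b1) * d + 4 * b1 * a2 * a3 = 0"
    using eqs(6) unfolding d_def by algebra
  have F3: "b1 * r = 2 * a1 * r + a1 * s"
    using eqs(7) F1 unfolding c_def r_def s_def by algebra
  \<comment> \<open>Components 2 and 3 of \<open>W *v oe 1\<close> vanish, so these two entries
    constrain \<alpha> without \<beta>.\<close>
  have \<alpha>r: "(\<alpha> + 2 * a1 * (a1 - b1)) * r = 0"
    using eqs(1,2) unfolding r_def by algebra
  have cd: "c\<^sup>2 + d\<^sup>2 = r * s"
    unfolding c_def d_def r_def s_def by algebra
  have pos: "r \<ge> 0" "s \<ge> 0" and r0: "r = 0 \<longleftrightarrow> a2 = 0 \<and> a3 = 0" and s0: "s = 0 \<longleftrightarrow> b2 = 0 \<and> b3 = 0"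
    by (auto simp: r_def s_def sum_power2_eq_zero_iff)
  have rs: "r \<noteq> 0 \<or> s \<noteq> 0"
    using nz unfolding r0 s0 q_def p_def complex_eq_iff by auto
  have "a1 = 0 \<and> b1 = 0"
  proof (cases "r = 0")
    case True
    then have a0: "a2 = 0" "a3 = 0" and "s > 0" using r0 rs pos by auto
    then have "a1 = 0" using F3 True by simp
    have "(\<alpha> - 2 * b1\<^sup>2) * s = 0"
      using eqs(11,12) a0 \<open>a1 = 0\<close> unfolding s_def by algebra
    then have "\<alpha> = 2 * b1\<^sup>2" using \<open>s > 0\<close> by simp
    then have "b1 * (s + b1\<^sup>2) = 0"
      using eqs(10) a0 \<open>a1 = 0\<close> unfolding s_def by algebra
    moreover have "s + b1\<^sup>2 > 0" using \<open>s > 0\<close> by (simp add: add_pos_nonneg)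
    ultimately show ?thesis using \<open>a1 = 0\<close> by simp
  next
    case False
    then have \<alpha>: "\<alpha> = - 2 * a1 * (a1 - b1)" using \<alpha>r by simp
    have ab: "(a1 + b1)\<^sup>2 * s = 0"
      using eqs(11,12) \<alpha> unfolding s_def by algebra
    show ?thesis
    proof (cases "s = 0")
      case True
      then have "(b1 * r)\<^sup>2 = 0"
        using F1 F2 s0 unfolding c_def d_def r_def by algebra
      then have "b1 = 0" using False by simp
      then show ?thesis using F3 False True by simp
    next
      case s: False
      then have b1: "b1 = - a1" using ab by (simp add: eq_neg_iff_add_eq_0 add.commute)
      \<comment> \<open>With \<open>b1 = - a1\<close>, \<open>F1\<close> and \<open>F2\<close> say
        that \<open>a1\<close> times \<open>cnj q * p - q^2\<close> is zero; \<open>cd\<close>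
        allows the moduli to be compared.\<close>
      have "a1\<^sup>2 * (r * s - r\<^sup>2) = 0"
        using F1 F2 cd unfolding b1 r_def by algebra
      then have "a1 = 0 \<or> s = r" using False by (auto simp: power2_eq_square)
      then show ?thesis using F3 False b1 by auto
    qed
  qed
  then show "a1 = 0" "b1 = 0" by simp_all
  then show "balanced \<beta>"
    using eqs(3,4,8,9) unfolding balanced_iff by algebra
qed

section \<open>The cubic equation for \<eta>\<close>

lemma balanced_iff_eta:
  assumes "q \<noteq> 0"
  shows "(\<exists>\<beta>. balanced \<beta>) \<longleftrightarrow>
    (\<exists>\<eta>\<in>{1, -1, -3::real}. of_real ((cmod q)\<^sup>2) * p = of_real \<eta> * q ^ 3)"
proof -
  define r where "r = (cmod q)\<^sup>2"
  define s where "s = (cmod p)\<^sup>2"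
  have r: "r > 0" and qq: "q * cnj q = of_real r"
    using assms complex_norm_square[of q] by (simp_all add: r_def)
  have q3: "q ^ 3 \<noteq> 0" and r0: "complex_of_real r \<noteq> 0" using assms r by simp_all
  \<comment> \<open>Since \<open>(cnj q)^2 * q^3 = r^2 * q\<close>, substituting for
    \<open>r * p\<close> makes the two left-hand sides real multiples of \<open>q\<close> and
    \<open>q^3\<close>. Each complex equation thereby becomes a single real one.\<close>
  have scaled: "of_real r * (of_real u * q + 6 * (cnj q)\<^sup>2 * p)
      = of_real (r * (u + 6 * \<eta> * r)) * q"
    "of_real r * (6 * q ^ 3 + of_real v * p) = of_real (6 * r + v * \<eta>) * q ^ 3"
    "s = \<eta>\<^sup>2 * r"
    if p: "of_real r * p = of_real \<eta> * q ^ 3" for u v \<eta>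
  proof -
    have "(cnj q)\<^sup>2 * (of_real r * p) = of_real \<eta> * (q * cnj q)\<^sup>2 * q"
      unfolding p by (simp add: power2_eq_square power3_eq_cube)
    then show "of_real r * (of_real u * q + 6 * (cnj q)\<^sup>2 * p) = of_real (r * (u + 6 * \<eta> * r)) * q"
      unfolding qq by (simp add: power2_eq_square algebra_simps)
    show "of_real r * (6 * q ^ 3 + of_real v * p) = of_real (6 * r + v * \<eta>) * q ^ 3"
      using p by (simp add: algebra_simps)
    have "(cmod (of_real r * p))\<^sup>2 = (cmod (of_real \<eta> * q ^ 3))\<^sup>2" by (simp add: p)
    then have "r\<^sup>2 * s = \<eta>\<^sup>2 * r ^ 3"
      by (simp add: norm_mult norm_power power_mult_distrib r_def s_def flip: power_mult)
    then have "r\<^sup>2 * (s - \<eta>\<^sup>2 * r) = 0" by algebra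
    then show "s = \<eta>\<^sup>2 * r" using r by simp
  qed
  have bal: "balanced \<beta> \<longleftrightarrow> 7 * r + 3 * s + \<beta> + 6 * \<eta> * r = 0 \<and> 6 * r + (9 * r + s + \<beta>) * \<eta> = 0"
    if p: "of_real r * p = of_real \<eta> * q ^ 3" for \<beta> \<eta>
  proof -
    have "of_real (7 * r + 3 * s + \<beta>) * q + 6 * (cnj q)\<^sup>2 * p = 0 \<longleftrightarrow> 7 * r + 3 * s + \<beta> + 6 * \<eta> * r = 0"
      using scaled(1)[OF p, of "7 * r + 3 * s + \<beta>"] r0 assms r
      by (metis mult_eq_0_iff of_real_eq_0_iff less_numeral_extra(3))
    moreover have "6 * q ^ 3 + of_real (9 * r + s + \<beta>) * p = 0 \<longleftrightarrow> 6 * r + (9 * r + s + \<beta>) * \<eta> = 0"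
      using scaled(2)[OF p, of "9 * r + s + \<beta>"] r0 q3
      by (metis mult_eq_0_iff of_real_eq_0_iff)
    ultimately show ?thesis by (simp add: balanced_def r_def s_def)
  qed
  \<comment> \<open>The first real equation is solved for \<beta>; inserting this value into the
    second leaves the cubic in \<eta>.\<close>
  have cubic: "6 * r + (9 * r + \<eta>\<^sup>2 * r + \<beta>) * \<eta> = - 2 * r * ((\<eta> - 1) * (\<eta> + 1) * (\<eta> + 3))"
    if "\<beta> = - (7 * r + 3 * (\<eta>\<^sup>2 * r) + 6 * \<eta> * r)" for \<beta> \<eta>
    unfolding that by (simp add: power2_eq_square algebra_simps)
  show ?thesis
    unfolding r_def[symmetric]
  proof
    assume "\<exists>\<beta>. balanced \<beta>"
    then obtain \<beta> where \<beta>: "balanced \<beta>" ..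
    \<comment> \<open>Multiplying the first balanced equation by \<open>q^2\<close> expresses
      \<open>r^2 * p\<close> as a real multiple of \<open>q^3\<close>; \<eta> is that factor divided
      by r.\<close>
    define \<eta> where "\<eta> = - (7 * r + 3 * s + \<beta>) / (6 * r)"
    have "of_real (7 * r + 3 * s + \<beta>) * q + 6 * (cnj q)\<^sup>2 * p = 0"
      using \<beta> by (simp add: balanced_def r_def s_def)
    then have "of_real (7 * r + 3 * s + \<beta>) * q ^ 3 + 6 * (q * cnj q)\<^sup>2 * p = 0" by algebra
    moreover have u: "7 * r + 3 * s + \<beta> = - 6 * r * \<eta>" using r by (simp add: \<eta>_def)
    ultimately have "of_real r * (of_real r * p - of_real \<eta> * q ^ 3) = 0"
      unfolding qq u by (simp add: power2_eq_square algebra_simps)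
    then have p: "of_real r * p = of_real \<eta> * q ^ 3" using r0 by simp
    have "(\<eta> - 1) * (\<eta> + 1) * (\<eta> + 3) = 0"
      using \<beta> cubic[of \<beta> \<eta>] r unfolding bal[OF p] scaled(3)[OF p] by auto
    then have "\<eta> \<in> {1, -1, -3}" by (auto simp: eq_neg_iff_add_eq_0)
    then show "\<exists>\<eta>\<in>{1, -1, -3}. of_real r * p = of_real \<eta> * q ^ 3" using p by blast
  next
    assume "\<exists>\<eta>\<in>{1, -1, -3::real}. of_real r * p = of_real \<eta> * q ^ 3"
    then obtain \<eta> :: real where \<eta>: "\<eta> \<in> {1, -1, -3}" and p: "of_real r * p = of_real \<eta> * q ^ 3" by blast
    show "\<exists>\<beta>. balanced \<beta>"
      unfolding bal[OF p] scaled(3)[OF p]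
      using cubic[OF refl, of \<eta>] \<eta> by (intro exI[of _ "- (7 * r + 3 * (\<eta>\<^sup>2 * r) + 6 * \<eta> * r)"]) auto
  qed
qed

lemma balanced_iff_cases:
  assumes "\<not> (q = 0 \<and> p = 0)"
  shows "(\<exists>\<beta>. balanced \<beta>) \<longleftrightarrow> (q = 0 \<and> p \<noteq> 0) \<or>
    (q \<noteq> 0 \<and> (\<exists>\<eta>\<in>{1, -1, -3::real}. of_real ((cmod q)\<^sup>2) * p = of_real \<eta> * q ^ 3))"
proof (cases "q = 0")
  case True
  \<comment> \<open>For \<open>q = 0\<close> the first equation is trivial and the second one reads
    \<open>(|p|^2 + \<beta>) * p = 0\<close>.\<close>
  then have "balanced (- ((cmod p)\<^sup>2))" by (simp add: balanced_def)
  then show ?thesis using True assms by blast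
next
  case False
  then show ?thesis using balanced_iff_eta by blast
qed

section \<open>The dimension of the generated algebra\<close>

lemma lie_generated_balanced:
  assumes "\<not> (q = 0 \<and> p = 0)" "a1 = 0" "b1 = 0" "balanced \<beta>"
  shows "dim (lie_generated U W) = 3" "lie_isomorphic (lie_generated U W) su2"
proof -
  note UT = bracket_of_balanced[OF assms(2-4)]
  show "dim (lie_generated U W) = 3" "lie_isomorphic (lie_generated U W) su2"
    using lie_generated_double_bracket[OF skew_U skew_W T_def _ UT double_bracket_W[OF UT]] assms(1)
    by (auto simp: T_eq_0_iff)
qed

lemma dim_le_3_iff:
  assumes "\<not> (q = 0 \<and> p = 0)"
  shows "dim (lie_generated U W) \<le> 3 \<longleftrightarrow> a1 = 0 \<and> b1 = 0 \<and> (\<exists>\<beta>. balanced \<beta>)"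
proof
  assume "dim (lie_generated U W) \<le> 3"
  then obtain \<alpha> \<beta> where "lie_bracket U T = \<alpha> *\<^sub>R U + \<beta> *\<^sub>R W"
    using lie_generated_dim_le_3D[OF skew_U skew_W T_def] assms T_eq_0_iff by blast
  then show "a1 = 0 \<and> b1 = 0 \<and> (\<exists>\<beta>. balanced \<beta>)"
    using balanced_of_bracket assms by blast
next
  assume "a1 = 0 \<and> b1 = 0 \<and> (\<exists>\<beta>. balanced \<beta>)"
  then show "dim (lie_generated U W) \<le> 3"
    using lie_generated_balanced(1)[OF assms] by fastforce
qed

text \<open>When \<open>q = p = 0\<close>, \<open>U\<close> is determined by the pair
  \<open>(2 * a1, b1 - a1)\<close>, and \<open>AdS\<close> swaps its entries. Hence \<open>W\<close>
  is a multiple of a nonzero \<open>U\<close> only if the entries are equal or opposite, which gives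
  the two exceptional lines.\<close>

lemma dim_commuting:
  assumes "q = 0" "p = 0"
  shows "a1 = 0 \<Longrightarrow> b1 = 0 \<Longrightarrow> dim (lie_generated U W) = 0"
    "\<not> (a1 = 0 \<and> b1 = 0) \<Longrightarrow> b1 = 3 * a1 \<or> b1 = - a1 \<Longrightarrow> dim (lie_generated U W) = 1"
    "b1 \<noteq> 3 * a1 \<Longrightarrow> b1 \<noteq> - a1 \<Longrightarrow> dim (lie_generated U W) = 2"
proof -
  have 0: "a2 = 0" "a3 = 0" "b2 = 0" "b3 = 0"
    using assms unfolding q_def p_def complex_eq_iff by simp_all
  have L: "lie_generated U W = span {U, W}"
    by (rule lie_generated_commuting) (use assms T_eq_0_iff T_def in simp)
  have W_eq: "W = k *\<^sub>R U" if "b1 - a1 = k * (2 * a1)" "k * (b1 - a1) = 2 * a1" "k * (a1 + b1) = a1 + b1" for k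
  proof (rule g2_eqI)
    show "W \<in> g2" "k *\<^sub>R U \<in> g2"
      by (auto intro: subspace_scale subspace_g2 U_g2 W_g2)
    note comps = vec8_eq U_apply W_apply vector_scaleR_component scaleR_matrix_vector_assoc[symmetric] oe_nth
    show "W *v oe 1 = (k *\<^sub>R U) *v oe 1" "W *v oe 2 = (k *\<^sub>R U) *v oe 2" "W *v oe 4 = (k *\<^sub>R U) *v oe 4"
      unfolding comps using 0 that by (simp_all add: algebra_simps)
  qed
  have entries: "(U *v oe 2) $ 3 = 2 * a1" "(U *v oe 4) $ 5 = b1 - a1"
    "(W *v oe 2) $ 3 = b1 - a1" "(W *v oe 4) $ 5 = 2 * a1"
    unfolding U_apply W_apply oe_nth by simp_all
  show "dim (lie_generated U W) = 0" if "a1 = 0" "b1 = 0"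
  proof -
    have "U = 0"
      by (intro g2_zeroI[OF U_g2]; unfold vec8_eq U_apply oe_nth) (use 0 that in simp_all)
    moreover have "W = 0"
      by (intro g2_zeroI[OF W_g2]; unfold vec8_eq W_apply oe_nth) (use 0 that in simp_all)
    ultimately have "span {U, W} = {0}" by simp
    then show ?thesis by (simp add: L)
  qed
  show "dim (lie_generated U W) = 1" if "\<not> (a1 = 0 \<and> b1 = 0)" "b1 = 3 * a1 \<or> b1 = - a1"
  proof -
    have "U \<noteq> 0" using entries(1,2) that(1) by auto
    moreover have "W = U \<or> W = - U"
      using that(2) W_eq[of 1] W_eq[of "- 1"] by auto
    then have "W \<in> span {U}" by (auto simp: span_base span_neg)
    then have "span {U, W} = span {U}"
      using span_redundant[of W "{U}"] by (simp add: insert_commute)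
    ultimately show ?thesis by (simp add: L dim_eq_card_independent)
  qed
  show "dim (lie_generated U W) = 2" if "b1 \<noteq> 3 * a1" "b1 \<noteq> - a1"
  proof -
    have "U \<notin> span {W}"
    proof
      assume "U \<in> span {W}"
      then obtain k where U: "U = k *\<^sub>R W" by (auto simp: span_singleton)
      have "2 * a1 = k * (b1 - a1)" "b1 - a1 = k * (2 * a1)"
        using entries unfolding U by (simp_all flip: scaleR_matrix_vector_assoc)
      \<comment> \<open>Eliminating k shows that \<open>b1 - a1\<close> and \<open>2 * a1\<close>
        have equal squares; the difference of squares is factored.\<close>
      then have "(b1 - 3 * a1) * (b1 + a1) = 0" by algebra
      then show False using that by (simp add: eq_neg_iff_add_eq_0)
    qed
    moreover have "W \<noteq> 0" using entries(3,4) that by auto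
    ultimately have "independent {U, W}" "U \<noteq> W"
      by (auto simp: independent_insert span_base)
    then show ?thesis by (simp add: L dim_eq_card_independent)
  qed
qed

section \<open>The common fixed space\<close>

definition fixed :: "octo set" where
  "fixed = {w \<in> ImO. U *v w = 0 \<and> W *v w = 0}"

text \<open>With \<open>a1 = b1 = 0\<close> the kernel equations decouple into conditions on
  \<open>w$1\<close> and on the pairs with indices (2,3), (4,5) and (6,7).\<close>

lemma fixed_iff:
  "w \<in> fixed \<longleftrightarrow> w$0 = 0
   \<and> a2 * w$3 = a3 * w$2 \<and> a2 * w$5 = a3 * w$4 \<and> a3 * w$1 = 0 \<and> a2 * w$1 = 0
   \<and> (a2 - b2) * w$6 + (a3 - b3) * w$7 = 0 \<and> (a2 + b2) * w$7 = (a3 + b3) * w$6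
   \<and> (a2 - b2) * w$4 = (a3 + b3) * w$5 \<and> (a3 - b3) * w$4 + (a2 + b2) * w$5 = 0
   \<and> (a2 - b2) * w$2 = (a3 + b3) * w$3 \<and> (a3 - b3) * w$2 + (a2 + b2) * w$3 = 0"
  if "a1 = 0" "b1 = 0"
  using that unfolding fixed_def mem_Collect_eq ImO_iff vec8_eq U_apply W_apply
  by (simp add: algebra_simps) argo

lemma dim_fixed_q_zero:
  assumes "a1 = 0" "b1 = 0" "q = 0" "p \<noteq> 0"
  shows "dim fixed = 1"
proof -
  have 0: "a2 = 0" "a3 = 0" using assms(3) unfolding q_def complex_eq_iff by simp_all
  have s: "b2\<^sup>2 + b3\<^sup>2 \<noteq> 0"
    using assms(4) unfolding p_def complex_eq_iff by (auto simp: sum_power2_eq_zero_iff)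
  \<comment> \<open>The determinant of this system is \<open>- |p|^2\<close>. It governs all three
    pairs, so only \<open>w$1\<close> remains free.\<close>
  have zero: "x = 0 \<and> y = 0" if "b2 * x + b3 * y = 0" "b3 * x - b2 * y = 0" for x y
  proof -
    have "(b2\<^sup>2 + b3\<^sup>2) * x = 0" "(b2\<^sup>2 + b3\<^sup>2) * y = 0" using that by algebra+
    then show ?thesis using s mult_eq_0_iff by blast
  qed
  have "w \<in> fixed \<longleftrightarrow> w \<in> span {oe 1}" for w
  proof
    assume "w \<in> fixed"
    note f = this[unfolded fixed_iff[OF assms(1,2)], unfolded 0]
    have "w$6 = 0 \<and> w$7 = 0" by (rule zero) (use f in \<open>simp_all add: algebra_simps\<close>)
    moreover have "w$4 = 0 \<and> w$5 = 0" by (rule zero) (use f in \<open>simp_all add: algebra_simps\<close>)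
    moreover have "w$2 = 0 \<and> w$3 = 0" by (rule zero) (use f in \<open>simp_all add: algebra_simps\<close>)
    ultimately have "w = w$1 *\<^sub>R oe 1" using f by (simp add: vec8_eq oe_nth)
    then show "w \<in> span {oe 1}" unfolding span_singleton by blast
  next
    assume "w \<in> span {oe 1}"
    then show "w \<in> fixed"
      unfolding span_singleton fixed_iff[OF assms(1,2)] by (auto simp: oe_nth 0)
  qed
  then have "fixed = span {oe 1}" by blast
  moreover have "oe 1 \<noteq> 0" by (simp add: vec8_eq oe_nth)
  ultimately show ?thesis by (simp add: dim_eq_card_independent)
qed

text \<open>Each pair is read as a complex number. Those with indices (2,3) and (4,5) must be real
  multiples of \<open>q\<close>, and the relation for \<open>p\<close> weights them by 1 - \<eta>.
  For (6,7) it weights the component along \<open>q^2\<close> by 1 - \<eta> and the one along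
  \<open>i * q^2\<close> by 1 + \<eta>.\<close>

lemma fixed_eta_iff:
  assumes "a1 = 0" "b1 = 0" "q \<noteq> 0" "of_real ((cmod q)\<^sup>2) * p = of_real \<eta> * q ^ 3"
  shows "w \<in> fixed \<longleftrightarrow> w$0 = 0 \<and> w$1 = 0 \<and> a2 * w$3 = a3 * w$2 \<and> a2 * w$5 = a3 * w$4
    \<and> (1 - \<eta>) * (a2 * w$2 + a3 * w$3) = 0 \<and> (1 - \<eta>) * (a2 * w$4 + a3 * w$5) = 0
    \<and> (1 - \<eta>) * ((a2\<^sup>2 - a3\<^sup>2) * w$6 + 2 * a2 * a3 * w$7) = 0
    \<and> (1 + \<eta>) * ((a2\<^sup>2 - a3\<^sup>2) * w$7 - 2 * a2 * a3 * w$6) = 0"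
proof -
  define r where "r = a2\<^sup>2 + a3\<^sup>2"
  have r: "r \<noteq> 0"
    using assms(3) unfolding q_def complex_eq_iff r_def by (auto simp: sum_power2_eq_zero_iff)
  have nr: "(cmod q)\<^sup>2 = r" by (simp add: q_def r_def cmod_power2)
  have "of_real r * p = of_real \<eta> * q ^ 3" using assms(4) by (simp only: nr)
  then have b2: "r * b2 = \<eta> * (a2 ^ 3 - 3 * a2 * a3\<^sup>2)" and b3: "r * b3 = \<eta> * (3 * a2\<^sup>2 * a3 - a3 ^ 3)"
    unfolding q_def p_def complex_eq_iff
    by (simp_all add: power2_eq_square power3_eq_cube algebra_simps)
  have cancel: "x = 0" if "r * x = 0" for x using that r by simp
  \<comment> \<open>Together these say \<open>cnj q * p = \<eta> * q^2\<close>.\<close>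
  have c: "a2 * b2 + a3 * b3 - \<eta> * (a2\<^sup>2 - a3\<^sup>2) = 0" and d: "a2 * b3 - a3 * b2 - \<eta> * (2 * a2 * a3) = 0"
    by (rule cancel; use b2 b3 in \<open>unfold r_def, algebra\<close>)+
  have parallel: "(a2 - b2) * x = (a3 + b3) * y \<and> (a3 - b3) * x + (a2 + b2) * y = 0
      \<longleftrightarrow> (1 - \<eta>) * (a2 * x + a3 * y) = 0" if xy: "a2 * y = a3 * x" for x y
  proof -
    define t where "t = a2 * x + a3 * y"
    have t: "r * x = a2 * t" "r * y = a3 * t" using xy unfolding t_def r_def by algebra+
    \<comment> \<open>For \<open>z = x + i y\<close> the two expressions are the real and imaginary
      parts of \<open>q * z - p * cnj z\<close>, and \<open>r * z = t * q\<close>.\<close>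
    have 1: "r * ((a2 - b2) * x - (a3 + b3) * y) = (1 - \<eta>) * t * (a2\<^sup>2 - a3\<^sup>2)"
      and 2: "r * ((a3 - b3) * x + (a2 + b2) * y) = (1 - \<eta>) * t * (2 * a2 * a3)"
      using t c d by algebra+
    show ?thesis
      unfolding t_def[symmetric]
    proof
      assume "(a2 - b2) * x = (a3 + b3) * y \<and> (a3 - b3) * x + (a2 + b2) * y = 0"
      then have "(1 - \<eta>) * t * (a2\<^sup>2 - a3\<^sup>2) = 0" "(1 - \<eta>) * t * (2 * a2 * a3) = 0"
        using 1 2 by simp_all
      then have "r * (r * ((1 - \<eta>) * t)) = 0" unfolding r_def by algebra
      then show "(1 - \<eta>) * t = 0" by (rule cancel[OF cancel])
    next
      assume t0: "(1 - \<eta>) * t = 0"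
      have "(a2 - b2) * x - (a3 + b3) * y = 0" "(a3 - b3) * x + (a2 + b2) * y = 0"
        by (rule cancel, unfold 1 2 t0, simp)+
      then show "(a2 - b2) * x = (a3 + b3) * y \<and> (a3 - b3) * x + (a2 + b2) * y = 0" by simp
    qed
  qed
  have last: "(a2 - b2) * x + (a3 - b3) * y = 0 \<and> (a2 + b2) * y = (a3 + b3) * x
      \<longleftrightarrow> (1 - \<eta>) * ((a2\<^sup>2 - a3\<^sup>2) * x + 2 * a2 * a3 * y) = 0
        \<and> (1 + \<eta>) * ((a2\<^sup>2 - a3\<^sup>2) * y - 2 * a2 * a3 * x) = 0" for x y
  proof -
    \<comment> \<open>For \<open>z = x + i y\<close> the two expressions are the parts of
      \<open>cnj q * z - p * cnj z\<close>, and r times this number is \<open>q * (C + i D)\<close>.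
      As \<open>q\<close> is nonzero, it vanishes exactly when C and D do.\<close>
    define C where "C = (1 - \<eta>) * ((a2\<^sup>2 - a3\<^sup>2) * x + 2 * a2 * a3 * y)"
    define D where "D = (1 + \<eta>) * ((a2\<^sup>2 - a3\<^sup>2) * y - 2 * a2 * a3 * x)"
    have 1: "r * ((a2 - b2) * x + (a3 - b3) * y) = a2 * C - a3 * D"
      and 2: "r * ((a2 + b2) * y - (a3 + b3) * x) = a2 * D + a3 * C"
      using b2 b3 unfolding C_def D_def r_def by algebra+
    show ?thesis
      unfolding C_def[symmetric] D_def[symmetric]
    proof
      assume "(a2 - b2) * x + (a3 - b3) * y = 0 \<and> (a2 + b2) * y = (a3 + b3) * x"
      then have "a2 * C - a3 * D = 0" "a2 * D + a3 * C = 0" using 1 2 by simp_all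
      then have "r * C = 0" "r * D = 0" unfolding r_def by algebra+
      then show "C = 0 \<and> D = 0" using r by simp
    next
      assume CD: "C = 0 \<and> D = 0"
      have "(a2 - b2) * x + (a3 - b3) * y = 0" "(a2 + b2) * y - (a3 + b3) * x = 0"
        by (rule cancel, unfold 1 2, simp add: CD)+
      then show "(a2 - b2) * x + (a3 - b3) * y = 0 \<and> (a2 + b2) * y = (a3 + b3) * x" by simp
    qed
  qed
  have "a3 * x = 0 \<and> a2 * x = 0 \<longleftrightarrow> x = 0" for x
    using r unfolding r_def by auto
  then show ?thesis
    unfolding fixed_iff[OF assms(1,2)]
    using last[of "w$6" "w$7"] parallel[of "w$3" "w$2"] parallel[of "w$5" "w$4"] by blast
qed

text \<open>For \<eta> = 1 the factor 1 - \<eta> frees one real direction in each of the three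
  pairs. For \<eta> = -1 only the direction \<open>i * q^2\<close> in the pair (6,7) is free, and
  for \<eta> = -3 neither factor vanishes.\<close>

lemma dim_fixed_eta:
  assumes "a1 = 0" "b1 = 0" "q \<noteq> 0" "of_real ((cmod q)\<^sup>2) * p = of_real \<eta> * q ^ 3"
  shows "\<eta> = 1 \<Longrightarrow> dim fixed = 3" "\<eta> = - 1 \<Longrightarrow> dim fixed = 1" "\<eta> = - 3 \<Longrightarrow> dim fixed = 0"
proof -
  define r where "r = a2\<^sup>2 + a3\<^sup>2"
  have a23: "a2 \<noteq> 0 \<or> a3 \<noteq> 0" using assms(3) unfolding q_def complex_eq_iff by auto
  then have r: "r \<noteq> 0" unfolding r_def by (auto simp: sum_power2_eq_zero_iff)
  have q2: "a2\<^sup>2 - a3\<^sup>2 \<noteq> 0 \<or> 2 * a2 * a3 \<noteq> 0" using a23 by auto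
  note fixed = fixed_eta_iff[OF assms]
  have parallel: "\<exists>t. x = t * a2 \<and> y = t * a3" if "a2 * y = a3 * x" for x y
  proof -
    have "r * x = (a2 * x + a3 * y) * a2" "r * y = (a2 * x + a3 * y) * a3"
      using that unfolding r_def by algebra+
    then show ?thesis using r by (intro exI[of _ "(a2 * x + a3 * y) / r"]) (simp add: field_simps)
  qed
  have parallel': "\<exists>t. x = t * (a2\<^sup>2 - a3\<^sup>2) \<and> y = t * (2 * a2 * a3)"
    if "(a2\<^sup>2 - a3\<^sup>2) * y - 2 * a2 * a3 * x = 0" for x y
  proof -
    \<comment> \<open>Up to the factor \<open>r^2 = |q^2|^2\<close>, c is the coefficient of the
      projection onto \<open>q^2\<close>.\<close>
    define c where "c = (a2\<^sup>2 - a3\<^sup>2) * x + 2 * a2 * a3 * y"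
    have "r\<^sup>2 * x = c * (a2\<^sup>2 - a3\<^sup>2)" "r\<^sup>2 * y = c * (2 * a2 * a3)"
      using that unfolding r_def c_def by algebra+
    then show ?thesis using r by (intro exI[of _ "c / r\<^sup>2"]) (simp add: eq_divide_eq mult.commute)
  qed
  have zero: "x = 0 \<and> y = 0" if "a2 * y = a3 * x" "a2 * x + a3 * y = 0" for x y
  proof -
    have "r * x = 0" "r * y = 0" using that unfolding r_def by algebra+
    then show ?thesis using r by simp
  qed
  have zero': "x = 0 \<and> y = 0"
    if "(a2\<^sup>2 - a3\<^sup>2) * y - 2 * a2 * a3 * x = 0" "(a2\<^sup>2 - a3\<^sup>2) * x + 2 * a2 * a3 * y = 0" for x y
  proof -
    have "r\<^sup>2 * x = 0" "r\<^sup>2 * y = 0" using that unfolding r_def by algebra+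
    then show ?thesis using r by simp
  qed
  define u where "u = a2 *\<^sub>R oe 2 + a3 *\<^sub>R oe 3"
  define v where "v = a2 *\<^sub>R oe 4 + a3 *\<^sub>R oe 5"
  define z where "z = (a2\<^sup>2 - a3\<^sup>2) *\<^sub>R oe 6 + (2 * a2 * a3) *\<^sub>R oe 7"
  define z' where "z' = (a2\<^sup>2 - a3\<^sup>2) *\<^sub>R oe 7 - (2 * a2 * a3) *\<^sub>R oe 6"
  note defs = u_def v_def z_def z'_def
  have nz: "u \<noteq> 0" "v \<noteq> 0" "z \<noteq> 0" "z' \<noteq> 0"
    using a23 q2 unfolding vec8_eq defs by (auto simp: oe_nth)
  have orth: "orthogonal u v" "orthogonal u z" "orthogonal v z"
    unfolding orthogonal_def inner_vec_def sum_index8 defs by (simp_all add: oe_nth)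
  show "dim fixed = 3" if "\<eta> = 1"
  proof -
    have "w \<in> fixed \<longleftrightarrow> w \<in> span {u, v, z}" for w
    proof
      assume "w \<in> fixed"
      note f = this[unfolded fixed]
      obtain k where k: "w$2 = k * a2" "w$3 = k * a3" using parallel f by blast
      obtain l where l: "w$4 = l * a2" "w$5 = l * a3" using parallel f by blast
      have "(a2\<^sup>2 - a3\<^sup>2) * w$7 - 2 * a2 * a3 * w$6 = 0" using f \<open>\<eta> = 1\<close> by (simp add: mult_ac)
      then obtain m where m: "w$6 = m * (a2\<^sup>2 - a3\<^sup>2)" "w$7 = m * (2 * a2 * a3)"
        using parallel' by blast
      have "w = k *\<^sub>R u + l *\<^sub>R v + m *\<^sub>R z"
        using f unfolding vec8_eq defs by (simp add: oe_nth k l m)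
      then show "w \<in> span {u, v, z}" unfolding span3_iff by blast
    next
      assume "w \<in> span {u, v, z}"
      then obtain a b c where w: "w = a *\<^sub>R u + b *\<^sub>R v + c *\<^sub>R z" unfolding span3_iff by blast
      show "w \<in> fixed"
        unfolding fixed w defs that by (simp add: oe_nth algebra_simps)
    qed
    then have "fixed = span {u, v, z}" by blast
    moreover have "u \<noteq> v" "u \<noteq> z" "v \<noteq> z" using orth nz by (auto simp: orthogonal_self)
    moreover have "independent {u, v, z}"
      by (rule pairwise_orthogonal_independent)
         (use orth nz in \<open>auto simp: pairwise_def orthogonal_commute\<close>)
    ultimately show ?thesis by (simp add: dim_eq_card_independent)
  qed
  show "dim fixed = 1" if "\<eta> = - 1"
  proof -
    have "w \<in> fixed \<longleftrightarrow> w \<in> span {z'}" for w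
    proof
      assume "w \<in> fixed"
      note f = this[unfolded fixed]
      have 0: "w$2 = 0 \<and> w$3 = 0" "w$4 = 0 \<and> w$5 = 0"
        by (rule zero; use f \<open>\<eta> = - 1\<close> in simp)+
      \<comment> \<open>Multiplying \<open>w$6 + i w$7\<close> by -i turns orthogonality to
        \<open>q^2\<close> into parallelism with \<open>q^2\<close>, so \<open>parallel'\<close>
        applies to the rotated pair.\<close>
      have "(a2\<^sup>2 - a3\<^sup>2) * (- w$6) - 2 * a2 * a3 * w$7 = 0" using f \<open>\<eta> = - 1\<close> by (simp add: mult_ac)
      then obtain m where m: "w$7 = m * (a2\<^sup>2 - a3\<^sup>2)" "- w$6 = m * (2 * a2 * a3)"
        using parallel' by blast
      have "w = m *\<^sub>R z'"
        using f 0 m unfolding vec8_eq defs by (simp add: oe_nth)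
      then show "w \<in> span {z'}" unfolding span_singleton by blast
    next
      assume "w \<in> span {z'}"
      then obtain c where w: "w = c *\<^sub>R z'" unfolding span_singleton by blast
      show "w \<in> fixed"
        unfolding fixed w defs that by (simp add: oe_nth algebra_simps)
    qed
    then have "fixed = span {z'}" by blast
    then show ?thesis using nz by (simp add: dim_eq_card_independent)
  qed
  show "dim fixed = 0" if "\<eta> = - 3"
  proof -
    have "w = 0" if "w \<in> fixed" for w
    proof -
      note f = that[unfolded fixed \<open>\<eta> = - 3\<close>]
      have "w$2 = 0 \<and> w$3 = 0" "w$4 = 0 \<and> w$5 = 0"
        by (rule zero; use f in simp)+
      moreover have "w$6 = 0 \<and> w$7 = 0"
      proof (rule zero')
        show "(a2\<^sup>2 - a3\<^sup>2) * w$7 - 2 * a2 * a3 * w$6 = 0" using f by (simp add: mult_ac)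
        show "(a2\<^sup>2 - a3\<^sup>2) * w$6 + 2 * a2 * a3 * w$7 = 0" using f by algebra
      qed
      ultimately show ?thesis using f unfolding vec8_eq by simp
    qed
    moreover have "0 \<in> fixed" unfolding fixed by simp
    ultimately have "fixed = {0}" by blast
    then show ?thesis by simp
  qed
qed

end

theorem theorem7p15:
  fixes x0 x1 x2 x3 x4 x5 :: real
    and Z :: "real ^ 8 ^ 8" and L :: "(real ^ 8 ^ 8) set"
    and a1 a2 a3 b1 b2 b3 :: real and q p :: complex
  assumes Z: "Z = x0 *\<^sub>R Dij 1 2 + x1 *\<^sub>R Dij 1 3 + x2 *\<^sub>R Dij 2 3
                + x3 *\<^sub>R Dij 4 5 + x4 *\<^sub>R Dij 4 6 + x5 *\<^sub>R Dij 4 7"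
    and L: "L = lie_generated Z (AdS Z)"
    and a: "a1 = 2 * x2 - x3" "a2 = - 2 * x1 - x4" "a3 = 2 * x0 - x5"
    and b: "b1 = 3 * x3" "b2 = 3 * x4" "b3 = 3 * x5"
    and q: "q = of_real a2 + \<i> * of_real a3"
    and p: "p = of_real b2 + \<i> * of_real b3"
  shows
    "(lie_abelian L \<longleftrightarrow> x0 = 0 \<and> x1 = 0 \<and> x4 = 0 \<and> x5 = 0)
     \<and> (x0 = 0 \<and> x1 = 0 \<and> x4 = 0 \<and> x5 = 0 \<longrightarrow>
          Z = x2 *\<^sub>R Dij 2 3 + x3 *\<^sub>R Dij 4 5
          \<and> (x2 = 0 \<and> x3 = 0 \<longrightarrow> dim L = 0)
          \<and> ((x2, x3) \<noteq> (0, 0) \<and> (x2 = x3 \<or> x2 = - x3) \<longrightarrow> dim L = 1)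
          \<and> (x2 \<noteq> x3 \<and> x2 \<noteq> - x3 \<longrightarrow> dim L = 2))
     \<and> (\<not> (x0 = 0 \<and> x1 = 0 \<and> x4 = 0 \<and> x5 = 0) \<longrightarrow>
       (dim L \<le> 3 \<longleftrightarrow>
          a1 = 0 \<and> b1 = 0 \<and>
          ((q = 0 \<and> p \<noteq> 0) \<or>
           (q \<noteq> 0 \<and> (\<exists>\<eta>\<in>{1, -1, -3::real}. of_real ((cmod q)\<^sup>2) * p = of_real \<eta> * q ^ 3))))
       \<and> (dim L \<le> 3 \<longrightarrow> lie_isomorphic L su2 \<and> dim L = 3))
     \<and> (\<not> (x0 = 0 \<and> x1 = 0 \<and> x4 = 0 \<and> x5 = 0) \<and> a1 = 0 \<and> b1 = 0 \<longrightarrow>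
       (q = 0 \<and> p \<noteq> 0 \<longrightarrow> dim (common_fixed_space Z) = 1)
       \<and> (q \<noteq> 0 \<and> of_real ((cmod q)\<^sup>2) * p = q ^ 3 \<longrightarrow> dim (common_fixed_space Z) = 3)
       \<and> (q \<noteq> 0 \<and> of_real ((cmod q)\<^sup>2) * p = - (q ^ 3) \<longrightarrow> dim (common_fixed_space Z) = 1)
       \<and> (q \<noteq> 0 \<and> of_real ((cmod q)\<^sup>2) * p = - 3 * q ^ 3 \<longrightarrow> dim (common_fixed_space Z) = 0))"
proof -
  interpret kA_element a1 a2 a3 b1 b2 b3 .
  have ZU: "Z = U"
    unfolding Z U_def unfolding a b by simp
  have LU: "L = lie_generated U W" by (simp add: L ZU W_def)
  have qp: "q = kA_element.q a2 a3" "p = kA_element.p b2 b3"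
    unfolding q p q_def p_def by (simp_all add: complex_eq_iff)
  \<comment> \<open>\<open>b2\<close> and \<open>b3\<close> vanish with \<open>x4\<close> and
    \<open>x5\<close>; after that \<open>a2\<close> and \<open>a3\<close> vanish with
    \<open>x1\<close> and \<open>x0\<close>.\<close>
  have plane: "x0 = 0 \<and> x1 = 0 \<and> x4 = 0 \<and> x5 = 0 \<longleftrightarrow> q = 0 \<and> p = 0"
    unfolding q p complex_eq_iff by (auto simp: a b)
  have F: "common_fixed_space Z = fixed"
    by (simp add: common_fixed_space_def fixed_def ZU W_def)
  have abelian: "lie_abelian L \<longleftrightarrow> x0 = 0 \<and> x1 = 0 \<and> x4 = 0 \<and> x5 = 0"
    unfolding plane LU lie_abelian_generated_iff qp using T_eq_0_iff unfolding T_def .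
  have dims: "(x2 = 0 \<and> x3 = 0 \<longrightarrow> dim L = 0)
      \<and> ((x2, x3) \<noteq> (0, 0) \<and> (x2 = x3 \<or> x2 = - x3) \<longrightarrow> dim L = 1)
      \<and> (x2 \<noteq> x3 \<and> x2 \<noteq> - x3 \<longrightarrow> dim L = 2)" if "q = 0 \<and> p = 0"
  proof -
    have "x2 = 0 \<and> x3 = 0 \<longleftrightarrow> a1 = 0 \<and> b1 = 0" "x2 = x3 \<longleftrightarrow> b1 = 3 * a1" "x2 = - x3 \<longleftrightarrow> b1 = - a1"
      by (auto simp: a b)
    then show ?thesis using dim_commuting that unfolding LU qp by auto
  qed
  have outside: "(dim L \<le> 3 \<longleftrightarrow>
          a1 = 0 \<and> b1 = 0 \<and>
          ((q = 0 \<and> p \<noteq> 0) \<or>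
           (q \<noteq> 0 \<and> (\<exists>\<eta>\<in>{1, -1, -3::real}. of_real ((cmod q)\<^sup>2) * p = of_real \<eta> * q ^ 3))))
       \<and> (dim L \<le> 3 \<longrightarrow> lie_isomorphic L su2 \<and> dim L = 3)" if "\<not> (q = 0 \<and> p = 0)"
    using that dim_le_3_iff balanced_iff_cases lie_generated_balanced unfolding LU qp by blast
  have fixed: "(q = 0 \<and> p \<noteq> 0 \<longrightarrow> dim (common_fixed_space Z) = 1)
       \<and> (q \<noteq> 0 \<and> of_real ((cmod q)\<^sup>2) * p = q ^ 3 \<longrightarrow> dim (common_fixed_space Z) = 3)
       \<and> (q \<noteq> 0 \<and> of_real ((cmod q)\<^sup>2) * p = - (q ^ 3) \<longrightarrow> dim (common_fixed_space Z) = 1)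
       \<and> (q \<noteq> 0 \<and> of_real ((cmod q)\<^sup>2) * p = - 3 * q ^ 3 \<longrightarrow> dim (common_fixed_space Z) = 0)"
    if "a1 = 0" "b1 = 0"
    using dim_fixed_q_zero[OF that] dim_fixed_eta(1)[OF that, of 1] dim_fixed_eta(2)[OF that, of "- 1"]
      dim_fixed_eta(3)[OF that, of "- 3"]
    unfolding F qp by simp
  have "Z = x2 *\<^sub>R Dij 2 3 + x3 *\<^sub>R Dij 4 5" if "x0 = 0 \<and> x1 = 0 \<and> x4 = 0 \<and> x5 = 0"
    using that by (simp add: Z)
  then show ?thesis
    using abelian dims outside fixed unfolding plane by blast
qed

end
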